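(* Let $\Gamma$ be a finite quiver, $\mathcal{A}_\Gamma$ its path $*$-algebra, and $d\ge 1$ an integer. Let $q\in(\mathcal{A}_\Gamma)_{d-1}$ be hermitian ($q=q^*$) and such that for every representation $\pi$ of $\mathcal{A}_\Gamma$ on a Hilbert space of dimension at most $\dim(\mathcal{A}_\Gamma)_d$ the operator $\pi(q)$ is positive semidefinite. Then $q\in\mathcal{C}_{2d}$, where $\mathcal{C}_{2d}$ is the convex hull of $\{ff^* : f\in(\mathcal{A}_\Gamma)_d\}$.
   Context: A quiver $\Gamma=(\Gamma_0,\Gamma_1)$ is a directed graph with finite vertex set $\Gamma_0$ and finite arrow set $\Gamma_1$; each arrow $b$ has an origin $o(b)$ and a terminal vertex $t(b)$. The double $\Gamma^*$ has the same vertices and arrows $\Gamma_1\cup\Gamma_1^*$, where $\Gamma_1^*=\{b^*: b\in\Gamma_1\}$ is a disjoint copy of $\Gamma_1$ and $o(b^* )=t(b)$, $t(b^* )=o(b)$. A path in $\Gamma^*$ is a finite sequence of arrows $(b_1,\dots,b_k)$ with $t(b_j)=o(b_{j+1})$; $k$ is its length; for each vertex $e$ there is an empty path of length $0$, also denoted $e$. The path $*$-algebra $\mathcal{A}_\Gamma$ is the complex vector space with basis $\mathcal{B}$ the set of all paths in $\Gamma^*$, with product given by concatenation of paths ($b_1b_2=0$ if $t(b_1)\ne o(b_2)$); its unit is the sum of all vertices. Its involution is the conjugate-linear anti-multiplicative map exchanging $b$ and $b^*$ for $b\in\Gamma_1$ and fixing each vertex $e$. For $t\ge 0$, $(\mathcal{A}_\Gamma)_t$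 denotes the linear span of the paths of length at most $t$. A representation of $\mathcal{A}_\Gamma$ on a finite dimensional Hilbert space $H$ is a (unital) $*$-homomorphism from $\mathcal{A}_\Gamma$ to the linear operators on $H$. *)

theory Defs
  imports
    "HOL-Analysis.Convex"
    "HOL-Library.Poly_Mapping"
    "Graph_Theory.Arc_Walk"
    "Jordan_Normal_Form.Schur_Decomposition"
begin

definition cscale :: "complex \<Rightarrow> ('k \<Rightarrow>\<^sub>0 complex) \<Rightarrow> ('k \<Rightarrow>\<^sub>0 complex)" where
  "cscale c x = Poly_Mapping.map ((*) c) x"

lemma lookup_cscale [simp]: "Poly_Mapping.lookup (cscale c x) k = c * Poly_Mapping.lookup x k"
  by (simp add: cscale_def Poly_Mapping.map.rep_eq when_def)

interpretation pm: vector_space "cscale :: complex \<Rightarrow> ('k \<Rightarrow>\<^sub>0 complex) \<Rightarrow> ('k \<Rightarrow>\<^sub>0 complex)"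
  by unfold_locales (auto intro!: poly_mapping_eqI simp: lookup_add algebra_simps)

text \<open>\<^const>\<open>convex\<close> and \<open>convex hull\<close> are only available over class \<^class>\<open>real_vector\<close>.\<close>

instantiation poly_mapping :: (type, real_vector) real_vector
begin

definition scaleR_poly_mapping :: "real \<Rightarrow> ('a \<Rightarrow>\<^sub>0 'b) \<Rightarrow> ('a \<Rightarrow>\<^sub>0 'b)" where
  "scaleR_poly_mapping r x = Poly_Mapping.map ((*\<^sub>R) r) x"

lemma lookup_scaleR [simp]:
  fixes x :: "'a \<Rightarrow>\<^sub>0 'b"
  shows "Poly_Mapping.lookup (r *\<^sub>R x) k = r *\<^sub>R Poly_Mapping.lookup x k"
  by (simp add: scaleR_poly_mapping_def Poly_Mapping.map.rep_eq when_def)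

instance
  by intro_classes (auto intro!: poly_mapping_eqI simp: lookup_add algebra_simps)

end

lemma scaleR_eq_cscale: "r *\<^sub>R x = cscale (complex_of_real r) x"
  by (rule poly_mapping_eqI) (simp add: scaleR_conv_of_real)

text \<open>
  A finite quiver is a \<^locale>\<open>fin_digraph\<close>, with origin map \<^const>\<open>tail\<close> and terminal
  map \<^const>\<open>head\<close>; loops and multiple arrows are allowed. In the double, \<^term>\<open>Inl b\<close>
  stands for the arrow \<open>b\<close> and \<^term>\<open>Inr b\<close> for \<open>b\<^sup>*\<close>.
\<close>

definition double :: "('v, 'a) pre_digraph \<Rightarrow> ('v, 'a + 'a) pre_digraph" where
  "double \<Gamma> =
     \<lparr>verts = verts \<Gamma>,
      arcs = arcs \<Gamma> <+> arcs \<Gamma>,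
      tail = case_sum (tail \<Gamma>) (head \<Gamma>),
      head = case_sum (head \<Gamma>) (tail \<Gamma>)\<rparr>"

lemma fin_digraph_double: "fin_digraph \<Gamma> \<Longrightarrow> fin_digraph (double \<Gamma>)"
  unfolding fin_digraph_def fin_digraph_axioms_def wf_digraph_def double_def by auto

text \<open>
  A path is stored as its initial vertex together with its list of arrows, so that
  \<^term>\<open>(e, [])\<close> is the empty path at \<open>e\<close>. For a nonempty path the initial vertex is
  determined by the first arrow.
\<close>

type_synonym ('v, 'a) qpath = "'v \<times> ('a + 'a) list"
type_synonym ('v, 'a) qalg = "('v, 'a) qpath \<Rightarrow>\<^sub>0 complex"

definition qpaths :: "('v, 'a) pre_digraph \<Rightarrow> ('v, 'a) qpath set" where
  "qpaths \<Gamma> = {(e, bs). \<exists>e'. pre_digraph.awalk (double \<Gamma>) e bs e'}"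

abbreviation qlength :: "('v, 'a) qpath \<Rightarrow> nat" where
  "qlength p \<equiv> length (snd p)"

definition qend :: "('v, 'a) pre_digraph \<Rightarrow> ('v, 'a) qpath \<Rightarrow> 'v" where
  "qend \<Gamma> p = last (pre_digraph.awalk_verts (double \<Gamma>) (fst p) (snd p))"

abbreviation basis_elem :: "('v, 'a) qpath \<Rightarrow> ('v, 'a) qalg" where
  "basis_elem p \<equiv> Poly_Mapping.single p 1"

definition path_algebra :: "('v, 'a) pre_digraph \<Rightarrow> ('v, 'a) qalg set" where
  "path_algebra \<Gamma> = pm.span (basis_elem ` qpaths \<Gamma>)"

definition path_algebra_upto :: "('v, 'a) pre_digraph \<Rightarrow> nat \<Rightarrow> ('v, 'a) qalg set" where
  "path_algebra_upto \<Gamma> t = pm.span (basis_elem ` {p \<in> qpaths \<Gamma>. qlength p \<le> t})"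

definition qconcat :: "('v, 'a) pre_digraph \<Rightarrow> ('v, 'a) qpath \<Rightarrow> ('v, 'a) qpath \<Rightarrow> ('v, 'a) qalg" where
  "qconcat \<Gamma> p r = (if qend \<Gamma> p = fst r then basis_elem (fst p, snd p @ snd r) else 0)"

definition qmult :: "('v, 'a) pre_digraph \<Rightarrow> ('v, 'a) qalg \<Rightarrow> ('v, 'a) qalg \<Rightarrow> ('v, 'a) qalg" where
  "qmult \<Gamma> x y =
     (\<Sum>p\<in>Poly_Mapping.keys x. \<Sum>r\<in>Poly_Mapping.keys y.
        cscale (Poly_Mapping.lookup x p * Poly_Mapping.lookup y r) (qconcat \<Gamma> p r))"

definition qone :: "('v, 'a) pre_digraph \<Rightarrow> ('v, 'a) qalg" where
  "qone \<Gamma> = (\<Sum>e\<in>verts \<Gamma>. basis_elem (e, []))"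

definition qpath_star :: "('v, 'a) pre_digraph \<Rightarrow> ('v, 'a) qpath \<Rightarrow> ('v, 'a) qpath" where
  "qpath_star \<Gamma> p = (qend \<Gamma> p, rev (map (case_sum Inr Inl) (snd p)))"

text \<open>
  The conjugate-linear extension of $(b_1 \cdots b_k)^* = b_k^* \cdots b_1^*$, which is
  what anti-multiplicativity forces from the values on arrows and vertices.
\<close>

definition qstar :: "('v, 'a) pre_digraph \<Rightarrow> ('v, 'a) qalg \<Rightarrow> ('v, 'a) qalg" where
  "qstar \<Gamma> x = (\<Sum>p\<in>Poly_Mapping.keys x.
       Poly_Mapping.single (qpath_star \<Gamma> p) (cnj (Poly_Mapping.lookup x p)))"

text \<open>
  Operators on an \<open>n\<close>-dimensional Hilbert space are given as complex \<open>n \<times> n\<close> matrices acting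
  on $\mathbb{C}^n$ with its standard inner product; every \<open>n\<close>-dimensional Hilbert space is
  isometric to it. A representation is constrained only on \<^term>\<open>path_algebra \<Gamma>\<close>.
\<close>

definition star_representation ::
    "('v, 'a) pre_digraph \<Rightarrow> nat \<Rightarrow> (('v, 'a) qalg \<Rightarrow> complex mat) \<Rightarrow> bool" where
  "star_representation \<Gamma> n \<pi> \<longleftrightarrow>
     (\<forall>x\<in>path_algebra \<Gamma>. \<pi> x \<in> carrier_mat n n) \<and>
     (\<forall>x\<in>path_algebra \<Gamma>. \<forall>y\<in>path_algebra \<Gamma>. \<pi> (x + y) = \<pi> x + \<pi> y) \<and>
     (\<forall>c. \<forall>x\<in>path_algebra \<Gamma>. \<pi> (cscale c x) = c \<cdot>\<^sub>m \<pi> x) \<and>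
     (\<forall>x\<in>path_algebra \<Gamma>. \<forall>y\<in>path_algebra \<Gamma>. \<pi> (qmult \<Gamma> x y) = \<pi> x * \<pi> y) \<and>
     (\<forall>x\<in>path_algebra \<Gamma>. \<pi> (qstar \<Gamma> x) = mat_adjoint (\<pi> x)) \<and>
     \<pi> (qone \<Gamma>) = 1\<^sub>m n"

text \<open>In the order on \<^typ>\<open>complex\<close>, \<open>0 \<le> z\<close> means that \<open>z\<close> is real and nonnegative.\<close>

definition positive_semidefinite :: "complex mat \<Rightarrow> bool" where
  "positive_semidefinite A \<longleftrightarrow>
     square_mat A \<and> mat_adjoint A = A \<and>
     (\<forall>v\<in>carrier_vec (dim_row A). 0 \<le> (A *\<^sub>v v) \<bullet>c v)"

text \<open>\<open>sos_hull \<Gamma> d\<close> is $\mathcal{C}_{2d}$: the squares lie in degree \<open>\<le> 2d\<close>.\<close>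

definition sos_hull :: "('v, 'a) pre_digraph \<Rightarrow> nat \<Rightarrow> ('v, 'a) qalg set" where
  "sos_hull \<Gamma> d = convex hull {qmult \<Gamma> f (qstar \<Gamma> f) | f. f \<in> path_algebra_upto \<Gamma> d}"

end

theory Submission
  imports Defs "HOL-Analysis.Function_Topology" "HOL-Analysis.Topology_Euclidean_Space"
begin

text \<open>
  Suppose \<open>q \<notin> C\<^sub>2\<^sub>d\<close>. Top-degree terms of sums of squares cannot cancel, so the finite
  dimensional cone \<open>C\<^sub>2\<^sub>d\<close> is generated by a compact set whose convex hull avoids the origin;
  hence it is closed, and there is a hermitian functional \<open>\<psi>\<close> with \<open>\<psi> (f f\<^sup>*) \<ge> 0\<close> for \<open>f\<close> of
  degree at most \<open>d\<close> and \<open>\<psi> q < 0\<close>. Let \<open>H\<close> be the Hilbert space obtained from the elements of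
  degree at most \<open>d - 1\<close> with the form \<open>\<langle>f, g\<rangle> = \<psi> (g\<^sup>* f)\<close>. Left multiplication by an arrow raises
  degrees, but its compression to \<open>H\<close> is well defined by the Cauchy-Schwarz inequality. Since the
  path algebra is free over its vertices, these compressions define a \<open>*\<close>-representation \<open>\<pi>\<close>. It
  satisfies \<open>\<pi>(p) 1 = p\<close> for paths \<open>p\<close> of length at most \<open>d - 1\<close>, so \<open>\<langle>\<pi>(q) 1, 1\<rangle> = \<psi> q < 0\<close>.
\<close>

section \<open>Separation from salient cones\<close>

text \<open>The obstacle is that positivity of \<psi> is known only up to degree \<open>d\<close>,
  while compressions are not multiplicative: compressing a product of two arrows loses less than
  compressing the arrows one by one. Therefore only vertices and arrows are compressed, and a longer
  path receives the product of the matrices of its arrows. What remains to be checked are the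
  relations between vertices and arrows, which survive because vertices preserve degree, and
  compatibility with the involution. An arrow raises the degree by at most one, so moving it across
  the form keeps degree \<open>d - 1\<close> inside degree \<open>d\<close>. This margin of one
  fixes the truncation, and it is why \<open>q\<close> has degree at most \<open>d - 1\<close>. The
  form may be degenerate. Instead of a quotient, a maximal orthonormal system of representatives is
  chosen; expansions then hold up to null vectors, and its size gives the dimension bound.
  Separation takes place in the infinite dimensional space of finitely supported functions. Finite
  dimension enters through the number of generators that an element of the cone requires.\<close>

lemma conic_caratheodory:
  fixes B S V :: "'a::real_vector set"
  assumes "finite B" "S \<subseteq> span B" "finite V" "V \<subseteq> S" "\<And>v. v \<in> V \<Longrightarrow> 0 \<le> u v"
  shows "\<exists>W w. finite W \<and> W \<subseteq> S \<and> card W \<le> card B \<and> (\<forall>v\<in>W. 0 \<le> w v) \<and>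
    (\<Sum>v\<in>W. w v *\<^sub>R v) = (\<Sum>v\<in>V. u v *\<^sub>R v)"
  using assms(3-5)
proof (induction "card V" arbitrary: V u rule: less_induct)
  case less
  show ?case
  proof (cases "card V \<le> card B")
    case True
    with less.prems show ?thesis by blast
  next
    case False
    with independent_span_bound[OF assms(1), of V] less.prems assms(2)
    have "dependent V" by auto
    then obtain a0 v0 where a0: "v0 \<in> V" "a0 v0 \<noteq> 0" "(\<Sum>v\<in>V. a0 v *\<^sub>R v) = 0"
      using dependent_finite[OF less.prems(1)] by auto
    \<comment> \<open>The relation is negated if necessary, so that some coefficient is positive and
      the ratios minimised below range over a nonempty set.\<close>
    define a where "a v = (if a0 v0 > 0 then a0 v else - a0 v)" for v
    have a: "a v0 > 0" "(\<Sum>v\<in>V. a v *\<^sub>R v) = 0"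
      using a0 by (cases "a0 v0 > 0"; simp add: a_def sum_negf)+
    let ?P = "{v \<in> V. a v > 0}"
    have P: "finite ?P" "?P \<noteq> {}" using less.prems a0 a by auto
    \<comment> \<open>The least ratio is the largest multiple of the relation that can be subtracted
      while all coefficients stay nonnegative; the coefficient at \<open>v1\<close> becomes zero, so
      \<open>V\<close> loses an element.\<close>
    obtain v1 where v1: "v1 \<in> ?P" "\<And>v. v \<in> ?P \<Longrightarrow> u v1 / a v1 \<le> u v / a v"
      using arg_min_if_finite(1)[OF P, of "\<lambda>v. u v / a v"]
        arg_min_least[OF P, of _ "\<lambda>v. u v / a v"] by blast
    define t where "t = u v1 / a v1"
    have t: "t \<ge> 0" using v1(1) less.prems(3) by (auto simp: t_def)
    have nn: "0 \<le> u v - t * a v" if "v \<in> V" for v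
    proof (cases "a v > 0")
      case True
      with v1(2)[of v] that show ?thesis by (simp add: t_def field_simps)
    next
      case False
      then have "t * a v \<le> 0" using t by (simp add: mult_nonneg_nonpos)
      with less.prems(3)[OF that] show ?thesis by linarith
    qed
    have z: "u v1 - t * a v1 = 0" using v1(1) by (simp add: t_def)
    have "(\<Sum>v\<in>V. u v *\<^sub>R v) = (\<Sum>v\<in>V. (u v - t * a v) *\<^sub>R v)"
      using a(2) by (simp add: scaleR_left_diff_distrib sum_subtractf flip: scaleR_scaleR scaleR_right.sum)
    also have "\<dots> = (\<Sum>v\<in>V - {v1}. (u v - t * a v) *\<^sub>R v)"
      using v1(1) less.prems(1) z by (simp add: sum.remove[of V v1])
    finally have eq: "(\<Sum>v\<in>V. u v *\<^sub>R v) = (\<Sum>v\<in>V - {v1}. (u v - t * a v) *\<^sub>R v)" .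
    have "card (V - {v1}) < card V" using v1(1) less.prems(1) by (intro psubset_card_mono) auto
    from less.hyps[OF this, of "\<lambda>v. u v - t * a v"] less.prems nn
    show ?thesis unfolding eq by auto
  qed
qed

text \<open>The number of summands is fixed so that the set is a finite sum of compact sets;
  \<open>conic_caratheodory\<close> supplies a number that suffices for the whole cone. The inserted
  0 pads shorter sums, also when \<open>S\<close> is empty.\<close>

primrec bounded_sums :: "'a::real_vector set \<Rightarrow> nat \<Rightarrow> 'a set" where
  "bounded_sums S 0 = {0}"
| "bounded_sums S (Suc n) =
     {x + y | x y. x \<in> insert 0 ((\<lambda>(c, x). c *\<^sub>R x) ` ({0..1} \<times> S)) \<and> y \<in> bounded_sums S n}"

lemma compact_bounded_sums:
  fixes S :: "'a::real_normed_vector set"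
  assumes "compact S"
  shows "compact (bounded_sums S n)"
proof (induction n)
  case (Suc n)
  have "compact ((\<lambda>(c, x). c *\<^sub>R x) ` ({0..1} \<times> S))"
    unfolding case_prod_beta
    by (intro compact_continuous_image compact_Times continuous_intros assms) simp
  from compact_sums[OF compact_insert[OF this] Suc] show ?case by simp
qed simp

lemma sum_in_bounded_sums:
  assumes "finite V" "V \<subseteq> S" "card V \<le> n" "\<And>v. v \<in> V \<Longrightarrow> 0 \<le> u v \<and> u v \<le> 1"
  shows "(\<Sum>v\<in>V. u v *\<^sub>R v) \<in> bounded_sums S n"
  using assms
proof (induction n arbitrary: V)
  case (Suc n)
  show ?case
  proof (cases "V = {}")
    case True
    with Suc.IH[of V] have "0 \<in> bounded_sums S n" by simp
    with True show ?thesis by force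
  next
    case False
    then obtain v where v: "v \<in> V" by auto
    have "(\<Sum>v\<in>V - {v}. u v *\<^sub>R v) \<in> bounded_sums S n"
      using Suc v by (intro Suc.IH) auto
    moreover have "(\<Sum>v\<in>V. u v *\<^sub>R v) = u v *\<^sub>R v + (\<Sum>v\<in>V - {v}. u v *\<^sub>R v)"
      using Suc.prems(1) v by (simp add: sum.remove)
    moreover have "u v *\<^sub>R v \<in> (\<lambda>(c, x). c *\<^sub>R x) ` ({0..1} \<times> S)"
      using Suc.prems v by (intro image_eqI[of _ _ "(u v, v)"]) auto
    ultimately show ?thesis unfolding bounded_sums.simps by blast
  qed
qed auto

section \<open>The convex cone generated by a set\<close>

definition conic_sums :: "'a::real_vector set \<Rightarrow> 'a set" where
  "conic_sums S = {\<Sum>v\<in>V. u v *\<^sub>R v | V u. finite V \<and> V \<subseteq> S \<and> (\<forall>v\<in>V. 0 \<le> u v)}"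

lemma conic_sumsI:
  "finite V \<Longrightarrow> V \<subseteq> S \<Longrightarrow> (\<And>v. v \<in> V \<Longrightarrow> 0 \<le> u v) \<Longrightarrow> x = (\<Sum>v\<in>V. u v *\<^sub>R v) \<Longrightarrow> x \<in> conic_sums S"
  unfolding conic_sums_def by blast

lemma zero_in_conic_sums: "0 \<in> conic_sums S"
  by (rule conic_sumsI[of "{}"]) auto

lemma conic_sums_scaleR:
  assumes "x \<in> conic_sums S" "0 \<le> c"
  shows "c *\<^sub>R x \<in> conic_sums S"
proof -
  obtain V u where "finite V" "V \<subseteq> S" "\<forall>v\<in>V. 0 \<le> u v" "x = (\<Sum>v\<in>V. u v *\<^sub>R v)"
    using assms(1) unfolding conic_sums_def by blast
  with assms(2) show ?thesis
    by (intro conic_sumsI[of V _ "\<lambda>v. c * u v"]) (auto simp: scaleR_sum_right)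
qed

text \<open>The vector \<open>s\<close> may already belong to \<open>V\<close>, in which case its
  coefficients must be merged. Adding two coefficient functions on \<open>insert s V\<close> treats
  both cases at once.\<close>

lemma sum_scaleR_insert:
  fixes V :: "'a::real_vector set"
  assumes "finite V"
  shows "(\<Sum>v\<in>insert s V. ((if v \<in> V then u v else 0) + (if v = s then c else 0)) *\<^sub>R v) =
    (\<Sum>v\<in>V. u v *\<^sub>R v) + c *\<^sub>R s"
proof -
  have "(\<Sum>v\<in>insert s V. (if v \<in> V then u v else 0) *\<^sub>R v) = (\<Sum>v\<in>V. u v *\<^sub>R v)"
    using assms by (intro sum.mono_neutral_cong_right) auto
  moreover have "(\<Sum>v\<in>insert s V. (if v = s then c else 0) *\<^sub>R v) = c *\<^sub>R s"
    using assms by (subst sum.remove[of _ s]) (auto intro!: sum.neutral)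
  ultimately show ?thesis by (simp add: scaleR_left_distrib sum.distrib)
qed

lemma conic_sums_add_mem:
  assumes "x \<in> conic_sums S" "s \<in> S" "0 \<le> c"
  shows "x + c *\<^sub>R s \<in> conic_sums S"
proof -
  obtain V u where "finite V" "V \<subseteq> S" "\<forall>v\<in>V. 0 \<le> u v" "x = (\<Sum>v\<in>V. u v *\<^sub>R v)"
    using assms(1) unfolding conic_sums_def by blast
  with assms(2,3) show ?thesis
    by (auto intro!: conic_sumsI[OF _ _ _ sum_scaleR_insert[where u = u and c = c, symmetric]])
qed

lemma bounded_sums_subset_conic_sums: "bounded_sums S n \<subseteq> conic_sums S"
proof (induction n)
  case (Suc n)
  show ?case
  proof
    fix z assume "z \<in> bounded_sums S (Suc n)"
    then obtain x y where z: "z = x + y" "y \<in> bounded_sums S n"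
      "x = 0 \<or> (\<exists>c s. x = c *\<^sub>R s \<and> 0 \<le> c \<and> s \<in> S)"
      by force
    with Suc conic_sums_add_mem[of y S] show "z \<in> conic_sums S"
      by (auto simp: add.commute)
  qed
qed (simp add: zero_in_conic_sums)

text \<open>First variation: the squared norm of \<open>a + t y\<close> has derivative
  \<open>2 * inner a y\<close> at 0, so a negative value would make a short step decrease the
  norm.\<close>

lemma nonneg_inner_of_norm_le:
  fixes a y :: "'a::real_inner"
  assumes "\<And>t. 0 < t \<Longrightarrow> t < 1 \<Longrightarrow> norm a \<le> norm (a + t *\<^sub>R y)"
  shows "0 \<le> inner a y"
proof (rule ccontr)
  assume "\<not> 0 \<le> inner a y"
  then have neg: "inner a y < 0" by simp
  \<comment> \<open>The summand 1 permits division by \<open>N\<close>. The step \<open>t\<close> is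
    so short that its quadratic term uses up at most one of the two copies of
    \<open>inner a y\<close>.\<close>
  define N where "N = 1 + inner y y"
  have N: "N \<ge> 1" by (simp add: N_def)
  define t where "t = min (1/2) (- inner a y / N)"
  have t: "0 < t" "t < 1" "t * N \<le> - inner a y"
    using neg N by (auto simp: t_def min_def field_simps)
  have "inner a a \<le> inner (a + t *\<^sub>R y) (a + t *\<^sub>R y)"
    using assms[OF t(1,2)] by (simp add: norm_eq_sqrt_inner)
  also have "\<dots> = inner a a + t * (2 * inner a y + t * inner y y)"
    by (simp add: inner_add_left inner_add_right inner_commute algebra_simps)
  finally have "0 \<le> t * (2 * inner a y + t * inner y y)" by simp
  then have "0 \<le> 2 * inner a y + t * inner y y" using t(1) by (simp add: zero_le_mult_iff)
  moreover have "t * inner y y \<le> t * N" using t(1) by (simp add: N_def)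
  ultimately show False using t(3) neg by linarith
qed

text \<open>
  The set \<open>E\<close> of sums with coefficients in \<open>[0, 1]\<close>, one of them equal to \<open>1\<close>, is compact and avoids
  the origin. If \<open>\<delta>\<close> is its distance from the origin, elements of the cone of norm at most \<open>M\<close>
  have coefficients at most \<open>M / \<delta>\<close>, which makes the cone closed. The separating vector points
  from \<open>q\<close> to the closest point of the cone.
\<close>

lemma conic_separation:
  fixes S B :: "'a::real_inner set"
  assumes "compact S" "finite B" "S \<subseteq> span B"
    and salient: "\<And>V u v. finite V \<Longrightarrow> V \<subseteq> S \<Longrightarrow> (\<And>v. v \<in> V \<Longrightarrow> 0 \<le> u v) \<Longrightarrow>
      (\<Sum>v\<in>V. u v *\<^sub>R v) = 0 \<Longrightarrow> v \<in> V \<Longrightarrow> u v = 0"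
    and "q \<notin> conic_sums S"
  shows "\<exists>a. inner a q < 0 \<and> (\<forall>s\<in>S. 0 \<le> inner a s)"
proof -
  define m where "m = card B"
  define E where "E = {x + y | x y. x \<in> S \<and> y \<in> bounded_sums S m}"
  have "compact E"
    unfolding E_def by (intro compact_sums compact_bounded_sums assms(1))
  \<comment> \<open>A zero in \<open>E\<close> would be a vanishing nonnegative combination in which
    \<open>x\<close> has coefficient at least 1, against salience.\<close>
  have "0 \<notin> E"
  proof
    assume "0 \<in> E"
    then obtain x y where xy: "x \<in> S" "y \<in> conic_sums S" "x + y = 0"
      unfolding E_def using bounded_sums_subset_conic_sums[of S m] by force
    obtain V u where V: "finite V" "V \<subseteq> S" "\<forall>v\<in>V. 0 \<le> u v" "y = (\<Sum>v\<in>V. u v *\<^sub>R v)"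
      using xy(2) unfolding conic_sums_def by blast
    define w where "w v = (if v \<in> V then u v else 0) + (if v = x then 1 else 0)" for v
    have "(\<Sum>v\<in>insert x V. w v *\<^sub>R v) = 0"
      using sum_scaleR_insert[OF V(1), where u = u and c = 1 and s = x] V(4) xy(3) by (simp add: w_def add.commute)
    from salient[OF _ _ _ this, of x] V xy(1) have "w x = 0" by (auto simp: w_def)
    then show False using V(3) by (auto simp: w_def split: if_splits)
  qed
  moreover have "open (- E)" using compact_imp_closed[OF \<open>compact E\<close>] by (rule open_Compl)
  ultimately obtain \<delta> where \<delta>: "\<delta> > 0" "ball 0 \<delta> \<subseteq> - E"
    using open_contains_ball by (metis ComplI)
  have \<delta>_le: "\<delta> \<le> norm x" if "x \<in> E" for x
    using \<delta>(2) that by (force simp: not_le[symmetric])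
  \<comment> \<open>Points of norm above \<open>2 * norm q\<close> are farther from \<open>q\<close>
    than the origin is, so the closest point can be sought below that norm. There \<delta> bounds
    all coefficients by \<open>R\<close>; the added 1 makes \<open>R\<close> visibly
    positive.\<close>
  define R where "R = 2 * norm q / \<delta> + 1"
  have R: "R > 0" using \<delta>(1) by (simp add: R_def add_nonneg_pos)
  \<comment> \<open>A compact part of the cone that contains all its points of norm at most
    \<open>2 * norm q\<close>.\<close>
  define D where "D = (\<lambda>x. R *\<^sub>R x) ` bounded_sums S m"
  have D: "compact D" unfolding D_def by (intro compact_scaling compact_bounded_sums assms(1))
  have D_sub: "D \<subseteq> conic_sums S"
    unfolding D_def using bounded_sums_subset_conic_sums R by (auto intro!: conic_sums_scaleR)
  have "0 \<in> bounded_sums S m" using sum_in_bounded_sums[of "{}" S m] by simp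
  then have D0: "0 \<in> D" unfolding D_def by (intro image_eqI[of _ _ 0]) auto
  have in_D: "x \<in> D" if x: "x \<in> conic_sums S" "norm x \<le> 2 * norm q" for x
  proof -
    from x(1) obtain V0 u0 where "finite V0" "V0 \<subseteq> S" "\<forall>v\<in>V0. 0 \<le> u0 v" "x = (\<Sum>v\<in>V0. u0 v *\<^sub>R v)"
      unfolding conic_sums_def by blast
    then obtain V u where V: "finite V" "V \<subseteq> S" "card V \<le> m" "\<forall>v\<in>V. 0 \<le> u v" "x = (\<Sum>v\<in>V. u v *\<^sub>R v)"
      using conic_caratheodory[OF assms(2,3), of V0 u0] unfolding m_def by metis
    have bound: "u v \<le> R" if "v \<in> V" for v
    proof -
      define M where "M = Max (u ` V)"
      have ne: "u ` V \<noteq> {}" "finite (u ` V)" using that V(1) by auto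
      have M: "u v \<le> M" if "v \<in> V" for v
        using that V(1) by (auto simp: M_def)
      obtain v1 where v1: "v1 \<in> V" "u v1 = M"
        using Max_in[OF ne(2,1)] by (auto simp: M_def)
      show ?thesis
      proof (cases "M > 0")
        case False
        with M[OF that] R show ?thesis by linarith
      next
        case True
        \<comment> \<open>Division by the largest coefficient leaves \<open>v1\<close> with
          coefficient exactly 1, which places the quotient in \<open>E\<close>.\<close>
        have "(1/M) *\<^sub>R x = (\<Sum>v\<in>V. (u v / M) *\<^sub>R v)"
          by (simp add: V(5) scaleR_sum_right)
        also have "\<dots> = v1 + (\<Sum>v\<in>V - {v1}. (u v / M) *\<^sub>R v)"
          using V(1) v1 True by (simp add: sum.remove[of V v1])
        also have "\<dots> \<in> E"
        proof -
          have "(\<Sum>v\<in>V - {v1}. (u v / M) *\<^sub>R v) \<in> bounded_sums S m"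
          proof (rule sum_in_bounded_sums)
            show "card (V - {v1}) \<le> m" using V(3) card_Diff1_le[of V v1] by linarith
          qed (use V True M in \<open>auto simp: field_simps\<close>)
          with v1 V(2) show ?thesis unfolding E_def by blast
        qed
        finally have "\<delta> \<le> norm ((1/M) *\<^sub>R x)" by (rule \<delta>_le)
        then have "M * \<delta> \<le> norm x" using True by (simp add: field_simps)
        then have "M \<le> 2 * norm q / \<delta>" using x(2) \<delta>(1) by (simp add: field_simps)
        with M[OF that] show ?thesis by (simp add: R_def)
      qed
    qed
    have "(\<Sum>v\<in>V. (u v / R) *\<^sub>R v) \<in> bounded_sums S m"
      using V bound R by (intro sum_in_bounded_sums) (auto simp: field_simps)
    moreover have "x = R *\<^sub>R (\<Sum>v\<in>V. (u v / R) *\<^sub>R v)"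
      using R by (simp add: V(5) scaleR_sum_right)
    ultimately show ?thesis unfolding D_def by blast
  qed
  have "\<exists>x\<in>D. \<forall>y\<in>D. dist q x \<le> dist q y"
    using D0 by (intro continuous_attains_inf D continuous_intros) auto
  then obtain p where p: "p \<in> D" "\<And>y. y \<in> D \<Longrightarrow> dist q p \<le> dist q y" by blast
  define a where "a = p - q"
  have closest: "norm a \<le> norm (x - q)" if "x \<in> conic_sums S" for x
  proof (cases "norm x \<le> 2 * norm q")
    case True
    with p(2)[OF in_D[OF that]] show ?thesis by (simp add: a_def dist_norm norm_minus_commute)
  next
    case False
    then have "norm q \<le> norm (x - q)" using norm_triangle_ineq2[of x q] by linarith
    moreover have "norm a \<le> norm q" using p(2)[OF D0] by (simp add: a_def dist_norm norm_minus_commute)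
    ultimately show ?thesis by linarith
  qed
  have pC: "p \<in> conic_sums S" using p(1) D_sub by blast
  have "0 \<le> inner a s" if "s \<in> S" for s
  proof (rule nonneg_inner_of_norm_le)
    fix t :: real assume "0 < t"
    with closest[OF conic_sums_add_mem[OF pC that, of t]]
    show "norm a \<le> norm (a + t *\<^sub>R s)" by (simp add: a_def algebra_simps)
  qed
  \<comment> \<open>Shrinking \<open>p\<close> towards the origin stays in the cone as long as
    \<open>t < 1\<close>. The outcome \<open>inner a p \<le> 0\<close> gives
    \<open>inner a q < 0\<close>, since the two differ by the squared norm of
    \<open>a\<close>.\<close>
  moreover have "0 \<le> inner a (- p)"
  proof (rule nonneg_inner_of_norm_le)
    fix t :: real assume "t < 1"
    with closest[OF conic_sums_scaleR[OF pC, of "1 - t"]]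
    show "norm a \<le> norm (a + t *\<^sub>R - p)" by (simp add: a_def algebra_simps)
  qed
  moreover have "a \<noteq> 0" using pC assms(5) by (auto simp: a_def)
  then have "inner a (p - q) > 0" by (simp add: a_def)
  ultimately show ?thesis
    by (intro exI[of _ a]) (simp add: inner_diff_right)
qed

section \<open>The inner product of finitely supported functions\<close>

instantiation poly_mapping :: (type, real_inner) real_inner
begin

text \<open>For complex coefficients this is the real part of the standard hermitian product. It
  supplies the norm and closest points needed by \<open>conic_separation\<close>; the topology is
  the one induced by this norm.\<close>

definition inner_poly_mapping :: "('a \<Rightarrow>\<^sub>0 'b) \<Rightarrow> ('a \<Rightarrow>\<^sub>0 'b) \<Rightarrow> real" where
  "inner_poly_mapping x y =
     (\<Sum>k\<in>Poly_Mapping.keys x. inner (Poly_Mapping.lookup x k) (Poly_Mapping.lookup y k))"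

definition norm_poly_mapping :: "('a \<Rightarrow>\<^sub>0 'b) \<Rightarrow> real" where
  "norm_poly_mapping x = sqrt (inner x x)"

definition sgn_poly_mapping :: "('a \<Rightarrow>\<^sub>0 'b) \<Rightarrow> ('a \<Rightarrow>\<^sub>0 'b)" where
  "sgn_poly_mapping x = x /\<^sub>R norm x"

definition dist_poly_mapping :: "('a \<Rightarrow>\<^sub>0 'b) \<Rightarrow> ('a \<Rightarrow>\<^sub>0 'b) \<Rightarrow> real" where
  "dist_poly_mapping x y = norm (x - y)"

definition uniformity_poly_mapping :: "(('a \<Rightarrow>\<^sub>0 'b) \<times> ('a \<Rightarrow>\<^sub>0 'b)) filter" where
  "uniformity_poly_mapping = (INF e\<in>{0<..}. principal {(x, y). dist x y < e})"

definition open_poly_mapping :: "('a \<Rightarrow>\<^sub>0 'b) set \<Rightarrow> bool" where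
  "open_poly_mapping U \<longleftrightarrow> (\<forall>x\<in>U. eventually (\<lambda>(x', y). x' = x \<longrightarrow> y \<in> U) uniformity)"

lemma inner_poly_mapping_superset:
  fixes x y :: "'a \<Rightarrow>\<^sub>0 'b"
  assumes "finite K" "Poly_Mapping.keys x \<subseteq> K"
  shows "inner x y = (\<Sum>k\<in>K. inner (Poly_Mapping.lookup x k) (Poly_Mapping.lookup y k))"
  unfolding inner_poly_mapping_def using assms
  by (intro sum.mono_neutral_left) (auto simp: in_keys_iff)

instance
proof
  fix x y z :: "'a \<Rightarrow>\<^sub>0 'b" and r :: real
  let ?K = "Poly_Mapping.keys x \<union> Poly_Mapping.keys y"
  show "inner x y = inner y x"
    by (simp add: inner_poly_mapping_superset[of ?K] inner_commute)
  show "inner (x + y) z = inner x z + inner y z"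
    using Poly_Mapping.keys_add[of x y]
    by (simp add: inner_poly_mapping_superset[of ?K] lookup_add inner_add_left sum.distrib)
  have "Poly_Mapping.keys (r *\<^sub>R x) \<subseteq> Poly_Mapping.keys x"
    by (auto simp: in_keys_iff)
  then show "inner (r *\<^sub>R x) y = r * inner x y"
    by (simp add: inner_poly_mapping_superset[of "Poly_Mapping.keys x"] sum_distrib_left)
  show "0 \<le> inner x x"
    unfolding inner_poly_mapping_def by (intro sum_nonneg) simp
  show "inner x x = 0 \<longleftrightarrow> x = 0"
    unfolding inner_poly_mapping_def
    by (subst sum_nonneg_eq_0_iff) (auto intro!: poly_mapping_eqI simp: in_keys_iff)
qed (simp_all only: norm_poly_mapping_def sgn_poly_mapping_def dist_poly_mapping_def
  uniformity_poly_mapping_def open_poly_mapping_def)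

end

section \<open>The path algebra\<close>

lemma qend_simp:
  "qend \<Gamma> (u, bs) = (if bs = [] then u else head (double \<Gamma>) (last bs))"
  by (simp add: qend_def pre_digraph.awalk_verts_conv)

lemma qend_Cons: "qend \<Gamma> (u, b # bs) = qend \<Gamma> (head (double \<Gamma>) b, bs)"
  by (simp add: qend_simp)

lemma keys_cscale: "Poly_Mapping.keys (cscale c x) \<subseteq> Poly_Mapping.keys x"
  by (auto simp: in_keys_iff)

lemma cscale_single: "cscale c (Poly_Mapping.single p a) = Poly_Mapping.single p (c * a)"
  by (rule poly_mapping_eqI) (simp add: lookup_single when_def)

lemma qalg_eq_sum:
  fixes x :: "('v, 'a) qalg"
  assumes "finite P" "Poly_Mapping.keys x \<subseteq> P"
  shows "x = (\<Sum>p\<in>P. cscale (Poly_Mapping.lookup x p) (basis_elem p))"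
proof (rule poly_mapping_eqI)
  fix k
  have "Poly_Mapping.lookup x k = 0" if "k \<notin> P" using assms(2) that by (meson in_keys_iff subsetD)
  with assms(1) show "Poly_Mapping.lookup x k =
      Poly_Mapping.lookup (\<Sum>p\<in>P. cscale (Poly_Mapping.lookup x p) (basis_elem p)) k"
    by (simp add: lookup_sum lookup_single when_def if_distrib[of "\<lambda>z. _ * z"] cong: if_cong)
qed

lemma span_basis_elem: "pm.span (basis_elem ` P) = {x :: ('v, 'a) qalg. Poly_Mapping.keys x \<subseteq> P}"
proof (rule Set.equalityI; rule subsetI)
  fix x :: "('v, 'a) qalg" assume "x \<in> pm.span (basis_elem ` P)"
  then have "Poly_Mapping.keys x \<subseteq> P"
  proof (induction rule: pm.span_induct_alt)
    case (step c x y)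
    then show ?case
      using Poly_Mapping.keys_add[of "cscale c x" y] keys_cscale[of c x] by fastforce
  qed simp
  then show "x \<in> {x. Poly_Mapping.keys x \<subseteq> P}" by simp
next
  fix x :: "('v, 'a) qalg" assume x: "x \<in> {x. Poly_Mapping.keys x \<subseteq> P}"
  have "x = (\<Sum>p\<in>Poly_Mapping.keys x. cscale (Poly_Mapping.lookup x p) (basis_elem p))"
    by (intro qalg_eq_sum) simp_all
  also have "\<dots> \<in> pm.span (basis_elem ` P)"
    using x by (intro pm.span_sum pm.span_scale pm.span_base) auto
  finally show "x \<in> pm.span (basis_elem ` P)" .
qed

lemma path_algebra_altdef: "path_algebra \<Gamma> = {x. Poly_Mapping.keys x \<subseteq> qpaths \<Gamma>}"
  by (simp add: path_algebra_def span_basis_elem)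

lemma path_algebra_upto_altdef:
  "path_algebra_upto \<Gamma> t = {x. Poly_Mapping.keys x \<subseteq> {p \<in> qpaths \<Gamma>. qlength p \<le> t}}"
  by (simp add: path_algebra_upto_def span_basis_elem)

lemma poly_mapping_span_induct [case_names zero step]:
  fixes x :: "('v, 'a) qalg"
  assumes "Poly_Mapping.keys x \<subseteq> P" "Q 0"
    "\<And>c p y. p \<in> P \<Longrightarrow> Poly_Mapping.keys y \<subseteq> P \<Longrightarrow> Q y \<Longrightarrow> Q (cscale c (basis_elem p) + y)"
  shows "Q x"
proof -
  from assms(1) have "x \<in> pm.span (basis_elem ` P)" by (simp add: span_basis_elem)
  then have "Poly_Mapping.keys x \<subseteq> P \<and> Q x"
  proof (induction rule: pm.span_induct_alt)
    case (step c x y)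
    then obtain p where "p \<in> P" "x = basis_elem p" by blast
    with step assms(3)[of p y c] Poly_Mapping.keys_add[of "cscale c x" y] keys_cscale[of c x]
    show ?case by fastforce
  qed (simp add: assms(2))
  then show ?thesis ..
qed

lemma subspace_path_algebra_upto: "pm.subspace (path_algebra_upto \<Gamma> t)"
  by (simp add: path_algebra_upto_def)

lemma path_algebra_upto_subset: "path_algebra_upto \<Gamma> t \<subseteq> path_algebra \<Gamma>"
  by (auto simp: path_algebra_altdef path_algebra_upto_altdef)

lemma path_algebra_upto_mono: "s \<le> t \<Longrightarrow> path_algebra_upto \<Gamma> s \<subseteq> path_algebra_upto \<Gamma> t"
  by (force simp: path_algebra_upto_altdef)

text \<open>Supports change under addition and scaling. Summing over any finite superset allows
  several elements to be expanded over one common index set, after which linearity is checked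
  termwise.\<close>

lemma qmult_superset:
  assumes "finite P" "finite R" "Poly_Mapping.keys x \<subseteq> P" "Poly_Mapping.keys y \<subseteq> R"
  shows "qmult \<Gamma> x y =
    (\<Sum>p\<in>P. \<Sum>r\<in>R. cscale (Poly_Mapping.lookup x p * Poly_Mapping.lookup y r) (qconcat \<Gamma> p r))"
proof -
  have "qmult \<Gamma> x y =
    (\<Sum>p\<in>P. \<Sum>r\<in>Poly_Mapping.keys y. cscale (Poly_Mapping.lookup x p * Poly_Mapping.lookup y r) (qconcat \<Gamma> p r))"
    unfolding qmult_def using assms
    by (intro sum.mono_neutral_left) (auto simp: in_keys_iff)
  also have "\<dots> = (\<Sum>p\<in>P. \<Sum>r\<in>R. cscale (Poly_Mapping.lookup x p * Poly_Mapping.lookup y r) (qconcat \<Gamma> p r))"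
    using assms by (intro sum.cong refl sum.mono_neutral_left) (auto simp: in_keys_iff)
  finally show ?thesis .
qed

lemma qmult_add_left: "qmult \<Gamma> (x + y) z = qmult \<Gamma> x z + qmult \<Gamma> y z"
proof -
  let ?P = "Poly_Mapping.keys x \<union> Poly_Mapping.keys y"
  have *: "qmult \<Gamma> w z = (\<Sum>p\<in>?P. \<Sum>r\<in>Poly_Mapping.keys z.
      cscale (Poly_Mapping.lookup w p * Poly_Mapping.lookup z r) (qconcat \<Gamma> p r))"
    if "Poly_Mapping.keys w \<subseteq> ?P" for w
    by (rule qmult_superset) (use that in auto)
  show ?thesis
    by (subst (1 2 3) *)
      (auto simp: Poly_Mapping.keys_add lookup_add algebra_simps pm.scale_left_distrib sum.distrib)
qed

lemma qmult_add_right: "qmult \<Gamma> z (x + y) = qmult \<Gamma> z x + qmult \<Gamma> z y"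
proof -
  let ?P = "Poly_Mapping.keys x \<union> Poly_Mapping.keys y"
  have *: "qmult \<Gamma> z w = (\<Sum>p\<in>Poly_Mapping.keys z. \<Sum>r\<in>?P.
      cscale (Poly_Mapping.lookup z p * Poly_Mapping.lookup w r) (qconcat \<Gamma> p r))"
    if "Poly_Mapping.keys w \<subseteq> ?P" for w
    by (rule qmult_superset) (use that in auto)
  show ?thesis
    by (subst (1 2 3) *)
      (auto simp: Poly_Mapping.keys_add lookup_add algebra_simps pm.scale_left_distrib sum.distrib)
qed

lemma qmult_cscale_left: "qmult \<Gamma> (cscale c x) y = cscale c (qmult \<Gamma> x y)"
  by (subst (1 2) qmult_superset[of "Poly_Mapping.keys x" "Poly_Mapping.keys y"])
    (auto simp: keys_cscale pm.scale_sum_right mult.assoc)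

lemma qmult_cscale_right: "qmult \<Gamma> x (cscale c y) = cscale c (qmult \<Gamma> x y)"
  by (subst (1 2) qmult_superset[of "Poly_Mapping.keys x" "Poly_Mapping.keys y"])
    (auto simp: keys_cscale pm.scale_sum_right algebra_simps)

lemma qmult_zero [simp]: "qmult \<Gamma> 0 x = 0" "qmult \<Gamma> x 0 = 0"
  by (simp_all add: qmult_def)

lemmas qmult_linear = qmult_add_left qmult_add_right qmult_cscale_left qmult_cscale_right

lemma qmult_sum_right: "qmult \<Gamma> x (\<Sum>i\<in>I. f i) = (\<Sum>i\<in>I. qmult \<Gamma> x (f i))"
  by (induction I rule: infinite_finite_induct) (auto simp: qmult_linear)

lemma qmult_sum_left: "qmult \<Gamma> (\<Sum>i\<in>I. f i) x = (\<Sum>i\<in>I. qmult \<Gamma> (f i) x)"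
  by (induction I rule: infinite_finite_induct) (auto simp: qmult_linear)

lemma qmult_basis: "qmult \<Gamma> (basis_elem p) (basis_elem r) = qconcat \<Gamma> p r"
  by (simp add: qmult_def)

text \<open>Linearity in each argument reduces this to basis elements. There \<open>qend\<close>
  depends only on the last arrow, or on the stored vertex of an empty list, so both bracketings
  impose the same two endpoint conditions, even on lists that are not paths.\<close>

lemma qmult_assoc: "qmult \<Gamma> (qmult \<Gamma> x y) z = qmult \<Gamma> x (qmult \<Gamma> y z)"
proof (rule poly_mapping_span_induct[of x UNIV])
  fix c p x' assume "qmult \<Gamma> (qmult \<Gamma> x' y) z = qmult \<Gamma> x' (qmult \<Gamma> y z)"
  moreover have "qmult \<Gamma> (qmult \<Gamma> (basis_elem p) y) z = qmult \<Gamma> (basis_elem p) (qmult \<Gamma> y z)"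
  proof (rule poly_mapping_span_induct[of y UNIV])
    fix c r y'
    assume "qmult \<Gamma> (qmult \<Gamma> (basis_elem p) y') z = qmult \<Gamma> (basis_elem p) (qmult \<Gamma> y' z)"
    moreover have "qmult \<Gamma> (qmult \<Gamma> (basis_elem p) (basis_elem r)) z =
        qmult \<Gamma> (basis_elem p) (qmult \<Gamma> (basis_elem r) z)"
    proof (rule poly_mapping_span_induct[of z UNIV])
      fix c s z'
      assume "qmult \<Gamma> (qmult \<Gamma> (basis_elem p) (basis_elem r)) z' =
        qmult \<Gamma> (basis_elem p) (qmult \<Gamma> (basis_elem r) z')"
      moreover have "qmult \<Gamma> (qconcat \<Gamma> p r) (basis_elem s) = qmult \<Gamma> (basis_elem p) (qconcat \<Gamma> r s)"
        by (cases p; cases r; cases s) (auto simp: qconcat_def qmult_basis qend_simp)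
      ultimately show "qmult \<Gamma> (qmult \<Gamma> (basis_elem p) (basis_elem r)) (cscale c (basis_elem s) + z') =
        qmult \<Gamma> (basis_elem p) (qmult \<Gamma> (basis_elem r) (cscale c (basis_elem s) + z'))"
        by (simp add: qmult_linear qmult_basis)
    qed simp_all
    ultimately show "qmult \<Gamma> (qmult \<Gamma> (basis_elem p) (cscale c (basis_elem r) + y')) z =
        qmult \<Gamma> (basis_elem p) (qmult \<Gamma> (cscale c (basis_elem r) + y') z)"
      by (simp add: qmult_linear)
  qed simp_all
  ultimately show "qmult \<Gamma> (qmult \<Gamma> (cscale c (basis_elem p) + x') y) z =
      qmult \<Gamma> (cscale c (basis_elem p) + x') (qmult \<Gamma> y z)"
    by (simp add: qmult_linear)
qed simp_all

section \<open>The involution and inductions over paths\<close>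

lemma qstar_superset:
  assumes "finite P" "Poly_Mapping.keys x \<subseteq> P"
  shows "qstar \<Gamma> x = (\<Sum>p\<in>P. Poly_Mapping.single (qpath_star \<Gamma> p) (cnj (Poly_Mapping.lookup x p)))"
  unfolding qstar_def using assms
  by (intro sum.mono_neutral_left) (auto simp: in_keys_iff)

lemma qstar_add: "qstar \<Gamma> (x + y) = qstar \<Gamma> x + qstar \<Gamma> y"
  by (subst (1 2 3) qstar_superset[of "Poly_Mapping.keys x \<union> Poly_Mapping.keys y"])
    (auto simp: Poly_Mapping.keys_add lookup_add single_add sum.distrib)

lemma qstar_cscale: "qstar \<Gamma> (cscale c x) = cscale (cnj c) (qstar \<Gamma> x)"
  by (subst (1 2) qstar_superset[of "Poly_Mapping.keys x"])
    (auto simp: keys_cscale pm.scale_sum_right cscale_single)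

lemma qstar_zero [simp]: "qstar \<Gamma> 0 = 0"
  by (simp add: qstar_def)

lemma qstar_basis [simp]: "qstar \<Gamma> (basis_elem p) = basis_elem (qpath_star \<Gamma> p)"
  by (simp add: qstar_def)

abbreviation flip_arrow :: "'a + 'a \<Rightarrow> 'a + 'a" where
  "flip_arrow \<equiv> case_sum Inr Inl"

lemma flip_flip [simp]: "flip_arrow (flip_arrow b) = b"
  by (cases b) auto

lemma double_flip [simp]:
  "tail (double \<Gamma>) (flip_arrow b) = head (double \<Gamma>) b"
  "head (double \<Gamma>) (flip_arrow b) = tail (double \<Gamma>) b"
  "flip_arrow b \<in> arcs (double \<Gamma>) \<longleftrightarrow> b \<in> arcs (double \<Gamma>)"
  by (cases b; auto simp: double_def)+

lemma verts_double [simp]: "verts (double \<Gamma>) = verts \<Gamma>"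
  by (simp add: double_def)

lemmas upto_closed =
  pm.subspace_0[OF subspace_path_algebra_upto]
  pm.subspace_add[OF subspace_path_algebra_upto]
  pm.subspace_diff[OF subspace_path_algebra_upto]
  pm.subspace_scale[OF subspace_path_algebra_upto]
  pm.subspace_sum[OF subspace_path_algebra_upto]

lemma path_algebra_induct [consumes 1, case_names zero step]:
  assumes "x \<in> path_algebra \<Gamma>" "Q 0"
    "\<And>c p y. p \<in> qpaths \<Gamma> \<Longrightarrow> y \<in> path_algebra \<Gamma> \<Longrightarrow> Q y \<Longrightarrow> Q (cscale c (basis_elem p) + y)"
  shows "Q x"
  using assms poly_mapping_span_induct[of x "qpaths \<Gamma>" Q] by (simp add: path_algebra_altdef)

lemma path_algebra_upto_induct [consumes 1, case_names zero step]:
  assumes "x \<in> path_algebra_upto \<Gamma> t" "Q 0"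
    "\<And>c p y. p \<in> qpaths \<Gamma> \<Longrightarrow> qlength p \<le> t \<Longrightarrow> y \<in> path_algebra_upto \<Gamma> t \<Longrightarrow> Q y \<Longrightarrow>
      Q (cscale c (basis_elem p) + y)"
  shows "Q x"
  using assms poly_mapping_span_induct[of x "{p \<in> qpaths \<Gamma>. qlength p \<le> t}" Q]
  by (simp add: path_algebra_upto_altdef)

lemma path_algebra_eq_upto: "x \<in> path_algebra \<Gamma> \<Longrightarrow> \<exists>t. x \<in> path_algebra_upto \<Gamma> t"
  using finite_keys[of x] by (force simp: path_algebra_altdef path_algebra_upto_altdef
    intro!: exI[of _ "Max (qlength ` Poly_Mapping.keys x)"] Max_ge)

lemma basis_in_upto: "p \<in> qpaths \<Gamma> \<Longrightarrow> qlength p \<le> t \<Longrightarrow> basis_elem p \<in> path_algebra_upto \<Gamma> t"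
  by (simp add: path_algebra_upto_altdef)

lemma basis_in_path_algebra: "p \<in> qpaths \<Gamma> \<Longrightarrow> basis_elem p \<in> path_algebra \<Gamma>"
  by (simp add: path_algebra_altdef)

section \<open>Paths of the double, their reversal, degrees and the unit\<close>

context
  fixes \<Gamma> :: "('v, 'a) pre_digraph"
  assumes fin_digraph: "fin_digraph \<Gamma>"
begin

interpretation D: fin_digraph "double \<Gamma>"
  by (rule fin_digraph_double[OF fin_digraph])

lemma qpaths_Nil: "(u, []) \<in> qpaths \<Gamma> \<longleftrightarrow> u \<in> verts \<Gamma>"
  unfolding qpaths_def by simp (metis D.awalk_Nil_iff verts_double)

lemma qpaths_Cons:
  "(u, b # bs) \<in> qpaths \<Gamma> \<longleftrightarrow>
     b \<in> arcs (double \<Gamma>) \<and> u = tail (double \<Gamma>) b \<and> (head (double \<Gamma>) b, bs) \<in> qpaths \<Gamma>"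
  by (auto simp: qpaths_def D.awalk_Cons_iff)

lemma qpaths_awalk: "p \<in> qpaths \<Gamma> \<longleftrightarrow> D.awalk (fst p) (snd p) (qend \<Gamma> p)"
  unfolding qpaths_def qend_def by (cases p) auto

lemma qend_in_verts: "p \<in> qpaths \<Gamma> \<Longrightarrow> qend \<Gamma> p \<in> verts \<Gamma>"
  using D.awalk_last_in_verts by (auto simp: qpaths_awalk)

lemma fst_in_verts: "p \<in> qpaths \<Gamma> \<Longrightarrow> fst p \<in> verts \<Gamma>"
  using D.awalk_hd_in_verts by (auto simp: qpaths_awalk)

lemma qpaths_append:
  assumes "p \<in> qpaths \<Gamma>" "r \<in> qpaths \<Gamma>" "qend \<Gamma> p = fst r"
  shows "(fst p, snd p @ snd r) \<in> qpaths \<Gamma>"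
proof -
  have "D.awalk (fst p) (snd p @ snd r) (qend \<Gamma> r)"
    using assms D.awalk_appendI unfolding qpaths_awalk by metis
  then show ?thesis by (auto simp: qpaths_def)
qed

lemma qend_append: "qend \<Gamma> p = fst r \<Longrightarrow> qend \<Gamma> (fst p, snd p @ snd r) = qend \<Gamma> r"
  by (cases p; cases r) (auto simp: qend_simp)

lemma finite_qpaths_upto: "finite {p \<in> qpaths \<Gamma>. qlength p \<le> t}"
proof (rule finite_subset)
  show "{p \<in> qpaths \<Gamma>. qlength p \<le> t} \<subseteq>
      verts \<Gamma> \<times> {bs. set bs \<subseteq> arcs (double \<Gamma>) \<and> length bs \<le> t}"
    by (auto simp: qpaths_def D.awalk_def)
  show "finite \<dots>"
    using D.finite_verts D.finite_arcs by (intro finite_cartesian_product finite_lists_length_le) auto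
qed

lemma qpath_star_awalk:
  assumes "D.awalk u bs v"
  shows "D.awalk v (rev (map flip_arrow bs)) u"
  using assms
proof (induction bs arbitrary: u)
  case (Cons b bs)
  then have *: "b \<in> arcs (double \<Gamma>)" "u = tail (double \<Gamma>) b" "D.awalk (head (double \<Gamma>) b) bs v"
    by (auto simp: D.awalk_Cons_iff)
  have "D.awalk (head (double \<Gamma>) b) [flip_arrow b] u"
    using * D.tail_in_verts[of b] by (simp add: D.awalk_Cons_iff D.awalk_Nil_iff)
  with Cons.IH[OF *(3)] show ?case by (auto intro: D.awalk_appendI)
qed (simp add: D.awalk_Nil_iff)

text \<open>For an arbitrary pair with a nonempty list, reversing twice replaces the stored vertex
  by the tail of the first arrow. On an actual path the two agree.\<close>

lemma qpath_star:
  assumes "p \<in> qpaths \<Gamma>"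
  shows "qpath_star \<Gamma> p \<in> qpaths \<Gamma>" "qend \<Gamma> (qpath_star \<Gamma> p) = fst p"
    "qpath_star \<Gamma> (qpath_star \<Gamma> p) = p"
proof -
  have *: "D.awalk (qend \<Gamma> p) (rev (map flip_arrow (snd p))) (fst p)"
    using assms by (intro qpath_star_awalk) (simp add: qpaths_awalk)
  show "qpath_star \<Gamma> p \<in> qpaths \<Gamma>"
    using * by (auto simp: qpaths_def qpath_star_def)
  show **: "qend \<Gamma> (qpath_star \<Gamma> p) = fst p"
    using * by (auto simp: qend_def qpath_star_def)
  have "map (flip_arrow \<circ> flip_arrow) (snd p) = snd p"
    by (rule map_idI) simp
  with ** show "qpath_star \<Gamma> (qpath_star \<Gamma> p) = p"
    by (simp add: qpath_star_def[of _ "qpath_star \<Gamma> p"]) (simp add: qpath_star_def rev_map)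
qed

lemma qpath_star_append:
  assumes "p \<in> qpaths \<Gamma>" "r \<in> qpaths \<Gamma>" "qend \<Gamma> p = fst r"
  shows "qpath_star \<Gamma> (fst p, snd p @ snd r) =
    (fst (qpath_star \<Gamma> r), snd (qpath_star \<Gamma> r) @ snd (qpath_star \<Gamma> p))"
  using qend_append[OF assms(3)] by (simp add: qpath_star_def)

text \<open>Reversal exchanges the endpoints, so the reversed pair is composable exactly when the
  original one is, and both sides vanish together.\<close>

lemma qstar_qconcat:
  assumes "p \<in> qpaths \<Gamma>" "r \<in> qpaths \<Gamma>"
  shows "qstar \<Gamma> (qconcat \<Gamma> p r) = qconcat \<Gamma> (qpath_star \<Gamma> r) (qpath_star \<Gamma> p)"
proof (cases "qend \<Gamma> p = fst r")
  case True
  with assms qpath_star(2)[of r] qpath_star_append[of p r] show ?thesis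
    by (simp add: qconcat_def) (simp add: qpath_star_def)
next
  case False
  with assms qpath_star(2)[of r] show ?thesis
    by (simp add: qconcat_def) (auto simp: qpath_star_def)
qed

lemma qmult_upto:
  assumes "x \<in> path_algebra_upto \<Gamma> s" "y \<in> path_algebra_upto \<Gamma> t"
  shows "qmult \<Gamma> x y \<in> path_algebra_upto \<Gamma> (s + t)"
  using assms(1)
proof (induction rule: path_algebra_upto_induct)
  case (step c p x)
  have "qmult \<Gamma> (basis_elem p) y \<in> path_algebra_upto \<Gamma> (s + t)"
    using assms(2)
  proof (induction rule: path_algebra_upto_induct)
    case (step c r y)
    with \<open>p \<in> qpaths \<Gamma>\<close> \<open>qlength p \<le> s\<close> have "qconcat \<Gamma> p r \<in> path_algebra_upto \<Gamma> (s + t)"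
      by (auto simp: qconcat_def upto_closed intro!: basis_in_upto qpaths_append)
    with step show ?case by (simp add: qmult_linear qmult_basis upto_closed)
  qed (simp add: upto_closed)
  with step show ?case by (simp add: qmult_linear upto_closed)
qed (simp add: upto_closed)

lemma qmult_in_path_algebra:
  assumes "x \<in> path_algebra \<Gamma>" "y \<in> path_algebra \<Gamma>"
  shows "qmult \<Gamma> x y \<in> path_algebra \<Gamma>"
proof -
  obtain s t where "x \<in> path_algebra_upto \<Gamma> s" "y \<in> path_algebra_upto \<Gamma> t"
    using assms path_algebra_eq_upto by metis
  then show ?thesis by (rule subsetD[OF path_algebra_upto_subset qmult_upto])
qed

lemma qstar_upto: "x \<in> path_algebra_upto \<Gamma> t \<Longrightarrow> qstar \<Gamma> x \<in> path_algebra_upto \<Gamma> t"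
proof (induction rule: path_algebra_upto_induct)
  case (step c p x)
  then have "basis_elem (qpath_star \<Gamma> p) \<in> path_algebra_upto \<Gamma> t"
    by (intro basis_in_upto qpath_star) (auto simp: qpath_star_def)
  with step show ?case by (simp add: qstar_add qstar_cscale upto_closed)
qed (simp add: upto_closed)

lemma qstar_in_path_algebra:
  assumes "x \<in> path_algebra \<Gamma>"
  shows "qstar \<Gamma> x \<in> path_algebra \<Gamma>"
proof -
  obtain t where "x \<in> path_algebra_upto \<Gamma> t"
    using assms path_algebra_eq_upto by metis
  then show ?thesis by (rule subsetD[OF path_algebra_upto_subset qstar_upto])
qed

lemma qstar_qstar: "x \<in> path_algebra \<Gamma> \<Longrightarrow> qstar \<Gamma> (qstar \<Gamma> x) = x"
  by (induction rule: path_algebra_induct) (simp_all add: qstar_add qstar_cscale qpath_star)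

lemma qstar_qmult:
  assumes "x \<in> path_algebra \<Gamma>" "y \<in> path_algebra \<Gamma>"
  shows "qstar \<Gamma> (qmult \<Gamma> x y) = qmult \<Gamma> (qstar \<Gamma> y) (qstar \<Gamma> x)"
  using assms(1)
proof (induction rule: path_algebra_induct)
  case (step c p x)
  have "qstar \<Gamma> (qmult \<Gamma> (basis_elem p) y) = qmult \<Gamma> (qstar \<Gamma> y) (qstar \<Gamma> (basis_elem p))"
    using assms(2)
  proof (induction rule: path_algebra_induct)
    case (step c r y)
    then show ?case
      using qstar_qconcat[OF \<open>p \<in> qpaths \<Gamma>\<close> step(1)]
      by (simp add: qmult_linear qstar_add qstar_cscale qmult_basis)
  qed simp
  with step show ?case by (simp add: qmult_linear qstar_add qstar_cscale)
qed simp

lemma qone_in_upto: "qone \<Gamma> \<in> path_algebra_upto \<Gamma> t"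
  unfolding qone_def by (intro upto_closed basis_in_upto) (auto simp: qpaths_Nil)

lemma qone_qmult: "x \<in> path_algebra \<Gamma> \<Longrightarrow> qmult \<Gamma> (qone \<Gamma>) x = x"
proof (induction rule: path_algebra_induct)
  case (step c p x)
  have "qmult \<Gamma> (qone \<Gamma>) (basis_elem p) = (\<Sum>e\<in>verts \<Gamma>. if e = fst p then basis_elem p else 0)"
    by (auto simp: qone_def qmult_sum_left qmult_basis qconcat_def qend_simp intro!: sum.cong)
  also have "\<dots> = basis_elem p"
    using fst_in_verts[OF step(1)] D.finite_verts by simp
  finally show ?case using step by (simp add: qmult_linear)
qed simp

lemma qmult_qone: "x \<in> path_algebra \<Gamma> \<Longrightarrow> qmult \<Gamma> x (qone \<Gamma>) = x"
proof (induction rule: path_algebra_induct)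
  case (step c p x)
  have "qmult \<Gamma> (basis_elem p) (qone \<Gamma>) = (\<Sum>e\<in>verts \<Gamma>. if qend \<Gamma> p = e then basis_elem p else 0)"
    by (auto simp: qone_def qmult_sum_right qmult_basis qconcat_def intro!: sum.cong)
  also have "\<dots> = basis_elem p"
    using qend_in_verts[OF step(1)] D.finite_verts by simp
  finally show ?case using step by (simp add: qmult_linear)
qed simp

lemma qstar_qone: "qstar \<Gamma> (qone \<Gamma>) = qone \<Gamma>"
proof -
  have "qstar \<Gamma> (\<Sum>e\<in>A. basis_elem (e, [])) = (\<Sum>e\<in>A. basis_elem (e, []))" if "finite A" for A
    using that by (induction rule: finite_induct) (simp_all add: qstar_add qpath_star_def qend_simp)
  with D.finite_verts show ?thesis by (simp add: qone_def)
qed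

text \<open>
  The path \<open>p p\<^sup>*\<close> with \<open>p\<close> of maximal length among the terms of \<open>f\<close> arises in \<open>f f\<^sup>*\<close> from
  the pair \<open>(p, p)\<close> only, so top-degree terms of sums of squares cannot cancel.
\<close>

lemma lookup_square_top:
  assumes f: "f \<in> path_algebra_upto \<Gamma> (qlength p)" and p: "p \<in> qpaths \<Gamma>"
  shows "Poly_Mapping.lookup (qmult \<Gamma> f (qstar \<Gamma> f)) (fst p, snd p @ rev (map flip_arrow (snd p))) =
    complex_of_real ((cmod (Poly_Mapping.lookup f p))\<^sup>2)"
proof -
  let ?K = "Poly_Mapping.keys f" and ?t = "(fst p, snd p @ rev (map flip_arrow (snd p)))"
  have K: "r \<in> qpaths \<Gamma>" "qlength r \<le> qlength p" if "r \<in> ?K" for r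
    using f that by (auto simp: path_algebra_upto_altdef)
  have f_sum: "f = (\<Sum>r\<in>?K. cscale (Poly_Mapping.lookup f r) (basis_elem r))"
    by (intro qalg_eq_sum) simp_all
  have f_star: "qstar \<Gamma> f = (\<Sum>r\<in>?K. cscale (cnj (Poly_Mapping.lookup f r)) (basis_elem (qpath_star \<Gamma> r)))"
    by (simp add: qstar_def cscale_single)
  have coeff: "Poly_Mapping.lookup (qconcat \<Gamma> r (qpath_star \<Gamma> s)) ?t = (if r = p \<and> s = p then 1 else 0)"
    if rs: "r \<in> ?K" "s \<in> ?K" for r s
  proof (cases "r = p \<and> s = p")
    case True
    then show ?thesis by (simp add: qconcat_def qpath_star_def)
  next
    case False
    have "\<not> (qend \<Gamma> r = qend \<Gamma> s \<and> (fst r, snd r @ rev (map flip_arrow (snd s))) = ?t)"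
    proof (rule notI, elim conjE)
      assume e: "qend \<Gamma> r = qend \<Gamma> s" and t: "(fst r, snd r @ rev (map flip_arrow (snd s))) = ?t"
      from t have "qlength r + qlength s = qlength p + qlength p"
        by (auto dest: arg_cong[of _ _ length])
      with K[OF rs(1)] K[OF rs(2)] have len: "qlength r = qlength p" "qlength s = qlength p" by auto
      with t have rp: "r = p" and m: "map flip_arrow (snd s) = map flip_arrow (snd p)"
        by (auto intro: prod_eqI)
      have "inj flip_arrow" by (rule inj_on_inverseI[of _ flip_arrow]) simp
      with m have "snd s = snd p" by (metis inj_map_eq_map)
      \<comment> \<open>Equal arrow lists do not determine the path when they are empty; the common
        end vertex does.\<close>
      then have "qpath_star \<Gamma> s = qpath_star \<Gamma> p"
        using e rp by (simp add: qpath_star_def)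
      with qpath_star(3) K(1)[OF rs(2)] p have "s = p" by metis
      with rp False show False by simp
    qed
    with False show ?thesis
      by (auto simp: qconcat_def qpath_star_def lookup_single when_def)
  qed
  have "Poly_Mapping.lookup (qmult \<Gamma> f (qstar \<Gamma> f)) ?t =
    (\<Sum>r\<in>?K. \<Sum>s\<in>?K. Poly_Mapping.lookup f r * (cnj (Poly_Mapping.lookup f s) *
       Poly_Mapping.lookup (qconcat \<Gamma> r (qpath_star \<Gamma> s)) ?t))"
    by (subst f_sum, subst f_star, subst sum.swap)
      (simp add: qmult_sum_left qmult_sum_right qmult_linear qmult_basis lookup_sum mult_ac
        pm.scale_sum_right)
  also have "\<dots> = (\<Sum>r\<in>?K. \<Sum>s\<in>?K. if s = p then if r = p then
      Poly_Mapping.lookup f p * cnj (Poly_Mapping.lookup f p) else 0 else 0)"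
    by (intro sum.cong refl) (auto simp: coeff)
  also have "\<dots> = Poly_Mapping.lookup f p * cnj (Poly_Mapping.lookup f p)"
    by (cases "Poly_Mapping.lookup f p = 0") (simp_all add: in_keys_iff)
  also have "\<dots> = complex_of_real ((cmod (Poly_Mapping.lookup f p))\<^sup>2)"
    by (rule complex_norm_square[symmetric])
  finally show ?thesis .
qed

end

section \<open>Closedness of the cone of sums of squares\<close>

text \<open>Reduces complex scalars to real ones, to which continuity of \<open>scaleR\<close> and
  the real \<open>span\<close> apply.\<close>

lemma cscale_Re_Im: "cscale z x = Re z *\<^sub>R x + Im z *\<^sub>R cscale \<i> x"
proof -
  have "cscale z x = cscale (of_real (Re z)) x + cscale (of_real (Im z) * \<i>) x"
    by (subst pm.scale_left_distrib[symmetric]) (simp add: complex_eq mult.commute)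
  then show ?thesis by (simp add: scaleR_eq_cscale)
qed

lemma continuous_on_cscale [continuous_intros]:
  assumes "continuous_on X g"
  shows "continuous_on X (\<lambda>t. cscale (g t) x)"
proof -
  have "continuous_on X (\<lambda>t. Re (g t) *\<^sub>R x + Im (g t) *\<^sub>R cscale \<i> x)"
    by (intro continuous_intros assms)
  then show ?thesis by (simp flip: cscale_Re_Im)
qed

text \<open>Outside \<open>I\<close> an extensional function takes the single value
  \<open>undefined\<close>, so the set is a full product of compact sets and Tychonoff's theorem
  applies.\<close>

lemma compact_PiE:
  fixes Y :: "'a \<Rightarrow> 'b::topological_space set"
  assumes "\<And>i. i \<in> I \<Longrightarrow> compact (Y i)"
  shows "compact (PiE I Y)"
proof -
  have eq: "PiE I Y = PiE UNIV (\<lambda>i. if i \<in> I then Y i else {undefined})"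
    by (auto simp: PiE_def Pi_def extensional_def split: if_splits)
  have "compactin (product_topology (\<lambda>_. euclidean) UNIV) (PiE I Y)"
    unfolding eq compactin_PiE using assms by (auto simp: compactin_euclidean_iff)
  then show ?thesis
    by (simp add: euclidean_product_topology compactin_euclidean_iff)
qed

text \<open>Normalising \<open>f\<close>, rather than its square, makes the generators a continuous
  image of a compact sphere.\<close>

definition unit_squares :: "('v, 'a) pre_digraph \<Rightarrow> nat \<Rightarrow> ('v, 'a) qalg set" where
  "unit_squares \<Gamma> d = {qmult \<Gamma> f (qstar \<Gamma> f) | f. f \<in> path_algebra_upto \<Gamma> d \<and> norm f = 1}"

context
  fixes \<Gamma> :: "('v, 'a) pre_digraph"
  assumes fin_digraph: "fin_digraph \<Gamma>"
begin

lemma compact_unit_squares: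
  "compact (unit_squares \<Gamma> d)"
  "\<exists>B. finite B \<and> unit_squares \<Gamma> d \<subseteq> span B"
proof -
  define P where "P = {p \<in> qpaths \<Gamma>. qlength p \<le> d}"
  have P: "finite P" unfolding P_def by (rule finite_qpaths_upto[OF fin_digraph])
  \<comment> \<open>The expanded square as a function of finitely many complex coefficients, hence
    visibly continuous.\<close>
  define G where "G F = (\<Sum>p\<in>P. \<Sum>r\<in>P. cscale (F p * cnj (F r)) (qconcat \<Gamma> p (qpath_star \<Gamma> r)))"
    for F :: "('v, 'a) qpath \<Rightarrow> complex"
  define X where "X = PiE P (\<lambda>_. cball (0 :: complex) 1) \<inter> {F. (\<Sum>p\<in>P. (cmod (F p))\<^sup>2) = 1}"
  have square: "qmult \<Gamma> f (qstar \<Gamma> f) = G (Poly_Mapping.lookup f)"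
    if "Poly_Mapping.keys f \<subseteq> P" for f
  proof -
    have "f = (\<Sum>p\<in>P. cscale (Poly_Mapping.lookup f p) (basis_elem p))"
      using P that by (rule qalg_eq_sum)
    moreover have "qstar \<Gamma> f = (\<Sum>r\<in>P. cscale (cnj (Poly_Mapping.lookup f r)) (basis_elem (qpath_star \<Gamma> r)))"
      using that P by (simp add: qstar_superset cscale_single)
    ultimately have "qmult \<Gamma> f (qstar \<Gamma> f) =
        qmult \<Gamma> (\<Sum>p\<in>P. cscale (Poly_Mapping.lookup f p) (basis_elem p))
          (\<Sum>r\<in>P. cscale (cnj (Poly_Mapping.lookup f r)) (basis_elem (qpath_star \<Gamma> r)))"
      by metis
    also have "\<dots> = G (Poly_Mapping.lookup f)"
      unfolding G_def
      by (simp add: qmult_sum_left qmult_sum_right qmult_linear qmult_basis pm.scale_sum_right)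
        (subst sum.swap, simp add: mult_ac)
    finally show ?thesis .
  qed
  have norm_eq: "norm f = 1 \<longleftrightarrow> (\<Sum>p\<in>P. (cmod (Poly_Mapping.lookup f p))\<^sup>2) = 1"
    if "Poly_Mapping.keys f \<subseteq> P" for f :: "('v, 'a) qalg"
    by (simp add: norm_eq_sqrt_inner inner_poly_mapping_superset[OF P that] power2_norm_eq_inner)
  have img: "unit_squares \<Gamma> d = G ` X"
  proof (rule Set.equalityI; rule subsetI)
    fix x assume "x \<in> unit_squares \<Gamma> d"
    then obtain f where f: "x = qmult \<Gamma> f (qstar \<Gamma> f)" "Poly_Mapping.keys f \<subseteq> P" "norm f = 1"
      unfolding unit_squares_def path_algebra_upto_altdef P_def by auto
    let ?F = "restrict (Poly_Mapping.lookup f) P"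
    have s: "(\<Sum>p\<in>P. (cmod (Poly_Mapping.lookup f p))\<^sup>2) = 1" using f norm_eq by blast
    have "cmod (Poly_Mapping.lookup f p) \<le> 1" if "p \<in> P" for p
    proof -
      have "(cmod (Poly_Mapping.lookup f p))\<^sup>2 \<le> 1"
        unfolding s[symmetric] using P that by (intro member_le_sum) auto
      then show ?thesis by (simp add: power2_le_iff_abs_le abs_square_le_1)
    qed
    with s have "?F \<in> X" by (auto simp: X_def)
    moreover have "G ?F = x" unfolding f(1) square[OF f(2)] by (simp add: G_def)
    ultimately show "x \<in> G ` X" by blast
  next
    fix x assume "x \<in> G ` X"
    then obtain F where F: "x = G F" "F \<in> X" by blast
    define f where "f = (\<Sum>p\<in>P. cscale (F p) (basis_elem p))"
    have lk: "Poly_Mapping.lookup f p = (if p \<in> P then F p else 0)" for p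
      using P by (auto simp: f_def lookup_sum lookup_single when_def if_distrib[of "\<lambda>z. _ * z"] cong: if_cong)
    then have keys: "Poly_Mapping.keys f \<subseteq> P" by (auto simp: in_keys_iff split: if_splits)
    have "x = qmult \<Gamma> f (qstar \<Gamma> f)"
      unfolding square[OF keys] F(1) by (simp add: G_def lk)
    moreover have "norm f = 1" using F(2) unfolding norm_eq[OF keys] X_def by (simp add: lk)
    moreover have "f \<in> path_algebra_upto \<Gamma> d" using keys by (simp add: path_algebra_upto_altdef P_def)
    ultimately show "x \<in> unit_squares \<Gamma> d" unfolding unit_squares_def by blast
  qed
  have coord: "continuous_on A (\<lambda>F. F p)" for A :: "(('v, 'a) qpath \<Rightarrow> complex) set" and p
    by (rule continuous_on_subset[OF continuous_on_product_coordinates]) simp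
  have "compact X"
    unfolding X_def
  proof (rule compact_Int_closed)
    show "closed {F :: ('v, 'a) qpath \<Rightarrow> complex. (\<Sum>p\<in>P. (cmod (F p))\<^sup>2) = 1}"
      by (intro closed_Collect_eq continuous_intros coord)
  qed (auto intro: compact_PiE)
  moreover have "continuous_on X G"
    unfolding G_def by (intro continuous_intros coord)
  ultimately show "compact (unit_squares \<Gamma> d)"
    unfolding img by (rule compact_continuous_image[rotated])
  \<comment> \<open>The span is over the reals, so each product of paths is accompanied by its
    multiple by the imaginary unit.\<close>
  define B where "B = (\<lambda>(p, r). qconcat \<Gamma> p (qpath_star \<Gamma> r)) ` (P \<times> P) \<union>
    (\<lambda>(p, r). cscale \<i> (qconcat \<Gamma> p (qpath_star \<Gamma> r))) ` (P \<times> P)"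
  have "G F \<in> span B" for F
    unfolding G_def
  proof (intro span_sum)
    fix p r assume "p \<in> P" "r \<in> P"
    then have "qconcat \<Gamma> p (qpath_star \<Gamma> r) \<in> B" "cscale \<i> (qconcat \<Gamma> p (qpath_star \<Gamma> r)) \<in> B"
      by (auto simp: B_def)
    then show "cscale (F p * cnj (F r)) (qconcat \<Gamma> p (qpath_star \<Gamma> r)) \<in> span B"
      by (subst cscale_Re_Im) (intro span_add span_scale span_base)
  qed
  moreover have "finite B" using P by (simp add: B_def)
  ultimately show "\<exists>B. finite B \<and> unit_squares \<Gamma> d \<subseteq> span B"
    unfolding img by blast
qed

text \<open>For a longest path \<open>p\<close> occurring in the chosen \<open>f v\<close> with
  positive weight, the coefficient of \<open>p\<close> times its star in the sum is a sum of
  nonnegative terms. All of them vanish, although \<open>p\<close> occurs in one of these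
  \<open>f v\<close>.\<close>

lemma unit_squares_salient:
  assumes V: "finite V" "V \<subseteq> unit_squares \<Gamma> d" "\<And>v. v \<in> V \<Longrightarrow> 0 \<le> u v"
    "(\<Sum>v\<in>V. u v *\<^sub>R v) = 0" "v0 \<in> V"
  shows "u v0 = 0"
proof (rule ccontr)
  assume "u v0 \<noteq> 0"
  \<comment> \<open>Members of weight zero are discarded first: a longest path found only there
    would contribute nothing to the sum.\<close>
  define U where "U = {v \<in> V. u v > 0}"
  have U: "finite U" "v0 \<in> U" using V \<open>u v0 \<noteq> 0\<close> by (force simp: U_def)+
  have "\<forall>v\<in>V. \<exists>f. f \<in> path_algebra_upto \<Gamma> d \<and> norm f = 1 \<and> v = qmult \<Gamma> f (qstar \<Gamma> f)"
    using V(2) unfolding unit_squares_def by blast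
  then obtain f where f: "\<And>v. v \<in> V \<Longrightarrow> f v \<in> path_algebra_upto \<Gamma> d" "\<And>v. v \<in> V \<Longrightarrow> norm (f v) = 1"
    "\<And>v. v \<in> V \<Longrightarrow> v = qmult \<Gamma> (f v) (qstar \<Gamma> (f v))"
    by metis
  define K where "K = (\<Union>v\<in>U. Poly_Mapping.keys (f v))"
  have "f v0 \<noteq> 0" using f(2)[OF V(5)] by auto
  then have "finite K" "K \<noteq> {}" using U by (auto simp: K_def)
  then obtain p where p: "p \<in> K" "\<And>r. r \<in> K \<Longrightarrow> qlength r \<le> qlength p"
    using Max_in[of "qlength ` K"] Max_ge[of "qlength ` K"]
    by (metis (no_types, lifting) finite_imageI image_iff image_is_empty imageI)
  have UV: "v \<in> V" if "v \<in> U" for v using that by (simp add: U_def)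
  have pq: "p \<in> qpaths \<Gamma>" using p(1) f(1) UV by (auto simp: K_def path_algebra_upto_altdef)
  let ?t = "(fst p, snd p @ rev (map flip_arrow (snd p)))"
  have lk: "Poly_Mapping.lookup v ?t = of_real ((cmod (Poly_Mapping.lookup (f v) p))\<^sup>2)" if "v \<in> U" for v
  proof -
    have "f v \<in> path_algebra_upto \<Gamma> (qlength p)"
      using f(1)[OF UV[OF that]] p(2) that by (auto simp: path_algebra_upto_altdef K_def)
    from lookup_square_top[OF fin_digraph this pq] f(3)[OF UV[OF that]] show ?thesis by metis
  qed
  have "(\<Sum>v\<in>U. u v *\<^sub>R v) = (\<Sum>v\<in>V. u v *\<^sub>R v)"
    using V(1,3) by (intro sum.mono_neutral_left) (force simp: U_def)+
  then have "0 = Poly_Mapping.lookup (\<Sum>v\<in>U. u v *\<^sub>R v) ?t" using V(4) by simp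
  also have "\<dots> = of_real (\<Sum>v\<in>U. u v * (cmod (Poly_Mapping.lookup (f v) p))\<^sup>2)"
    by (simp add: lookup_sum lk scaleR_conv_of_real)
  finally have "complex_of_real (\<Sum>v\<in>U. u v * (cmod (Poly_Mapping.lookup (f v) p))\<^sup>2) = 0"
    by (rule sym)
  then have 0: "(\<Sum>v\<in>U. u v * (cmod (Poly_Mapping.lookup (f v) p))\<^sup>2) = 0"
    by (simp only: of_real_eq_0_iff)
  have nn: "0 \<le> u v * (cmod (Poly_Mapping.lookup (f v) p))\<^sup>2" if "v \<in> U" for v
    using that by (simp add: U_def)
  from p(1) obtain v where v: "v \<in> U" "p \<in> Poly_Mapping.keys (f v)" by (auto simp: K_def)
  with 0 nn U(1) have "u v * (cmod (Poly_Mapping.lookup (f v) p))\<^sup>2 = 0"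
    by (simp add: sum_nonneg_eq_0_iff)
  with v show False by (simp add: U_def in_keys_iff)
qed

text \<open>A factor \<open>c\<close> is absorbed by scaling \<open>f\<close> with
  \<open>sqrt c\<close>, so the squares are closed under nonnegative multiples. A sum of
  \<open>card V\<close> terms is then the average of \<open>card V\<close> times each of them, which
  is a convex combination.\<close>

lemma conic_sums_unit_squares: "conic_sums (unit_squares \<Gamma> d) \<subseteq> sos_hull \<Gamma> d"
proof
  fix x assume "x \<in> conic_sums (unit_squares \<Gamma> d)"
  then obtain V u where V: "finite V" "V \<subseteq> unit_squares \<Gamma> d" "\<forall>v\<in>V. 0 \<le> u v" "x = (\<Sum>v\<in>V. u v *\<^sub>R v)"
    unfolding conic_sums_def by blast
  let ?T = "{qmult \<Gamma> f (qstar \<Gamma> f) | f. f \<in> path_algebra_upto \<Gamma> d}"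
  have sq: "c *\<^sub>R v \<in> ?T" if "v \<in> unit_squares \<Gamma> d" "0 \<le> c" for v c
  proof -
    obtain f where f: "f \<in> path_algebra_upto \<Gamma> d" "v = qmult \<Gamma> f (qstar \<Gamma> f)"
      using \<open>v \<in> unit_squares \<Gamma> d\<close> unfolding unit_squares_def by blast
    let ?g = "cscale (of_real (sqrt c)) f"
    have "qmult \<Gamma> ?g (qstar \<Gamma> ?g) = c *\<^sub>R v"
      using that(2) by (simp add: f(2) qstar_cscale qmult_linear scaleR_eq_cscale flip: of_real_mult)
    moreover have "?g \<in> path_algebra_upto \<Gamma> d" by (intro upto_closed f)
    ultimately show ?thesis by (metis (mono_tags, lifting) mem_Collect_eq)
  qed
  show "x \<in> sos_hull \<Gamma> d"
  proof (cases "V = {}")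
    case True
    have "0 \<in> ?T" by (auto intro!: exI[of _ 0] upto_closed)
    with True V show ?thesis by (simp add: sos_hull_def hull_inc)
  next
    case False
    then have c: "real (card V) > 0" using V(1) by (simp add: card_gt_0_iff)
    have "x = (\<Sum>v\<in>V. (1 / real (card V)) *\<^sub>R ((real (card V) * u v) *\<^sub>R v))"
      using c by (simp add: V(4))
    also have "\<dots> \<in> convex hull ?T"
      using V c by (intro convex_sum convex_convex_hull hull_inc sq) auto
    finally show ?thesis by (simp add: sos_hull_def)
  qed
qed

section \<open>From the separating vector to a hermitian functional\<close>

lemma separating_functional:
  assumes q: "qstar \<Gamma> q = q" "q \<notin> sos_hull \<Gamma> d"
  shows "\<exists>\<psi>. (\<forall>x y. \<psi> (x + y) = \<psi> x + \<psi> y) \<and> (\<forall>c x. \<psi> (cscale c x) = c * \<psi> x) \<and>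
    (\<forall>x\<in>path_algebra \<Gamma>. \<psi> (qstar \<Gamma> x) = cnj (\<psi> x)) \<and>
    (\<forall>f\<in>path_algebra_upto \<Gamma> d. 0 \<le> \<psi> (qmult \<Gamma> f (qstar \<Gamma> f))) \<and> \<psi> q < 0"
proof -
  obtain B where "finite B" "unit_squares \<Gamma> d \<subseteq> span B" using compact_unit_squares(2) by blast
  moreover have "q \<notin> conic_sums (unit_squares \<Gamma> d)" using q(2) conic_sums_unit_squares by blast
  ultimately have "\<exists>a. inner a q < 0 \<and> (\<forall>s\<in>unit_squares \<Gamma> d. 0 \<le> inner a s)"
    by (intro conic_separation compact_unit_squares(1)) (auto intro: unit_squares_salient)
  then obtain a where a: "inner a q < 0" "\<And>s. s \<in> unit_squares \<Gamma> d \<Longrightarrow> 0 \<le> inner a s"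
    by blast
  have sq: "0 \<le> inner a (qmult \<Gamma> f (qstar \<Gamma> f))" if "f \<in> path_algebra_upto \<Gamma> d" for f
  proof (cases "f = 0")
    case False
    let ?g = "cscale (of_real (1 / norm f)) f"
    have "norm ?g = 1" unfolding scaleR_eq_cscale[symmetric] using False by simp
    moreover have "?g \<in> path_algebra_upto \<Gamma> d" by (intro upto_closed that)
    ultimately have "0 \<le> inner a (qmult \<Gamma> ?g (qstar \<Gamma> ?g))"
      by (intro a(2)) (auto simp: unit_squares_def)
    also have "qmult \<Gamma> ?g (qstar \<Gamma> ?g) = (1 / (norm f)\<^sup>2) *\<^sub>R qmult \<Gamma> f (qstar \<Gamma> f)"
      by (simp add: qstar_cscale qmult_linear scaleR_eq_cscale power2_eq_square)
    finally show ?thesis using False by (simp add: zero_le_divide_iff)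
  qed simp
  \<comment> \<open>The complex linear functional with real part \<open>inner a\<close>.\<close>
  define \<rho> where "\<rho> x = Complex (inner a x) (- inner a (cscale \<i> x))" for x
  have \<rho>_add: "\<rho> (x + y) = \<rho> x + \<rho> y" for x y
    by (simp add: \<rho>_def complex_eq_iff pm.scale_right_distrib inner_add_right)
  have \<rho>_cscale: "\<rho> (cscale c x) = c * \<rho> x" for c x
  proof -
    have "cscale \<i> (cscale c x) = Re c *\<^sub>R cscale \<i> x - Im c *\<^sub>R x"
      by (rule poly_mapping_eqI) (simp add: lookup_minus complex_eq_iff algebra_simps)
    then show ?thesis
      by (simp add: \<rho>_def complex_eq_iff inner_diff_right cscale_Re_Im[of c] inner_add_right)
  qed
  \<comment> \<open>Symmetrising under the involution makes the functional hermitian; on hermitian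
    elements it keeps only the real part of \<rho>, so the signs on squares and on \<open>q\<close>
    are preserved.\<close>
  define \<psi> where "\<psi> x = (\<rho> x + cnj (\<rho> (qstar \<Gamma> x))) / 2" for x
  have herm: "\<psi> x = of_real (inner a x)" if "qstar \<Gamma> x = x" for x
    using that by (simp add: \<psi>_def \<rho>_def complex_eq_iff)
  have "0 \<le> \<psi> (qmult \<Gamma> f (qstar \<Gamma> f))" if "f \<in> path_algebra_upto \<Gamma> d" for f
  proof -
    have f: "f \<in> path_algebra \<Gamma>" using that path_algebra_upto_subset by blast
    then have "qstar \<Gamma> (qmult \<Gamma> f (qstar \<Gamma> f)) = qmult \<Gamma> f (qstar \<Gamma> f)"
      by (simp add: qstar_qmult[OF fin_digraph] qstar_qstar[OF fin_digraph] qstar_in_path_algebra[OF fin_digraph])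
    then show ?thesis using sq[OF that] by (simp add: herm less_eq_complex_def)
  qed
  moreover have "\<psi> q < 0" using a(1) by (simp add: herm q(1) less_complex_def)
  moreover have "\<psi> (qstar \<Gamma> x) = cnj (\<psi> x)" if "x \<in> path_algebra \<Gamma>" for x
    by (simp add: \<psi>_def qstar_qstar[OF fin_digraph that] add.commute)
  moreover have "\<psi> (x + y) = \<psi> x + \<psi> y" for x y
    by (simp add: \<psi>_def \<rho>_add qstar_add field_simps)
  moreover have "\<psi> (cscale c x) = c * \<psi> x" for c x
    by (simp add: \<psi>_def \<rho>_cscale qstar_cscale field_simps)
  ultimately show ?thesis by (intro exI[of _ \<psi>]) simp
qed

end

section \<open>The truncated GNS construction\<close>

lemma mat_adjoint_index [simp]:
  "i < dim_col A \<Longrightarrow> j < dim_row A \<Longrightarrow> dim_row A = dim_col A \<Longrightarrow>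
     mat_adjoint A $$ (i, j) = cnj (A $$ (j, i))"
  for A :: "complex mat"
  by (simp add: mat_adjoint_def mat_of_rows_def conjugate_vec_def)

lemma mat_adjoint_dim [simp]:
  "dim_row (mat_adjoint A) = dim_col A" "dim_col (mat_adjoint A) = dim_row A"
  by (simp_all add: mat_adjoint_def)

lemma mat_adjoint_mult:
  fixes A B :: "complex mat"
  assumes "A \<in> carrier_mat n n" "B \<in> carrier_mat n n"
  shows "mat_adjoint (A * B) = mat_adjoint B * mat_adjoint A"
  using assms
  by (intro eq_matI) (auto simp: scalar_prod_def mult.commute)

locale positive_functional =
  fixes \<Gamma> :: "('v, 'a) pre_digraph" and d :: nat and \<psi> :: "('v, 'a) qalg \<Rightarrow> complex"
  assumes fin_digraph: "fin_digraph \<Gamma>"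
    and d_pos: "d \<ge> 1"
    and \<psi>_add: "\<psi> (x + y) = \<psi> x + \<psi> y"
    and \<psi>_cscale: "\<psi> (cscale c x) = c * \<psi> x"
    and \<psi>_qstar: "x \<in> path_algebra \<Gamma> \<Longrightarrow> \<psi> (qstar \<Gamma> x) = cnj (\<psi> x)"
    and \<psi>_square: "f \<in> path_algebra_upto \<Gamma> d \<Longrightarrow> 0 \<le> \<psi> (qmult \<Gamma> f (qstar \<Gamma> f))"
begin

section \<open>The positive semidefinite form on low degrees\<close>

definition ip :: "('v, 'a) qalg \<Rightarrow> ('v, 'a) qalg \<Rightarrow> complex" where
  "ip f g = \<psi> (qmult \<Gamma> (qstar \<Gamma> g) f)"

lemma \<psi>_0 [simp]: "\<psi> 0 = 0"
  using \<psi>_cscale[of 0 0] by simp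

lemma ip_linear:
  "ip (f + g) h = ip f h + ip g h"
  "ip (cscale c f) h = c * ip f h"
  "ip h (f + g) = ip h f + ip h g"
  "ip h (cscale c f) = cnj c * ip h f"
  by (simp_all add: ip_def qmult_linear qstar_add qstar_cscale \<psi>_add \<psi>_cscale)

lemma ip_0 [simp]: "ip 0 f = 0" "ip f 0 = 0"
  by (simp_all add: ip_def)

lemma ip_minus: "ip (f - g) h = ip f h - ip g h"
  using ip_linear(1)[of "f - g" g h] by simp

lemma ip_sum: "ip (\<Sum>i\<in>I. f i) h = (\<Sum>i\<in>I. ip (f i) h)"
  by (induction I rule: infinite_finite_induct) (simp_all add: ip_linear)

lemma upto_path: "f \<in> path_algebra_upto \<Gamma> t \<Longrightarrow> f \<in> path_algebra \<Gamma>"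
  using path_algebra_upto_subset by blast

lemma upto_d: "f \<in> path_algebra_upto \<Gamma> (d - 1) \<Longrightarrow> f \<in> path_algebra_upto \<Gamma> d"
  using path_algebra_upto_mono[of "d - 1" d \<Gamma>] by auto

lemma ip_cnj:
  assumes "f \<in> path_algebra \<Gamma>" "g \<in> path_algebra \<Gamma>"
  shows "cnj (ip f g) = ip g f"
  unfolding ip_def using assms
  by (simp add: \<psi>_qstar[symmetric] qmult_in_path_algebra qstar_in_path_algebra fin_digraph
    qstar_qmult qstar_qstar)

text \<open>The form evaluates \<psi> on the star of \<open>f\<close> times \<open>f\<close>, which
  is the square of the star of \<open>f\<close>, an element of the same degree bound.\<close>

lemma ip_nonneg:
  assumes "f \<in> path_algebra_upto \<Gamma> d"
  shows "0 \<le> ip f f"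
  using \<psi>_square[OF qstar_upto[OF fin_digraph assms]] qstar_qstar[OF fin_digraph upto_path[OF assms]]
  by (simp add: ip_def)

lemma ip_qmult:
  assumes "x \<in> path_algebra \<Gamma>" "g \<in> path_algebra \<Gamma>"
  shows "ip (qmult \<Gamma> x f) g = ip f (qmult \<Gamma> (qstar \<Gamma> x) g)"
  using assms by (simp add: ip_def qstar_qmult qstar_qstar qstar_in_path_algebra fin_digraph qmult_assoc)

lemma ip_qmult_right:
  assumes "x \<in> path_algebra \<Gamma>" "g \<in> path_algebra \<Gamma>"
  shows "ip f (qmult \<Gamma> x g) = ip (qmult \<Gamma> (qstar \<Gamma> x) f) g"
  using ip_qmult[of "qstar \<Gamma> x" g f] assms by (simp add: qstar_qstar qstar_in_path_algebra fin_digraph)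

lemma ip_adjoint:
  assumes "x \<in> path_algebra \<Gamma>" "f \<in> path_algebra \<Gamma>" "g \<in> path_algebra \<Gamma>"
  shows "ip (qmult \<Gamma> x f) g = cnj (ip (qmult \<Gamma> (qstar \<Gamma> x) g) f)"
  unfolding ip_qmult[OF assms(1,3)]
  by (rule ip_cnj[symmetric]) (intro qmult_in_path_algebra qstar_in_path_algebra fin_digraph assms)+

text \<open>The degenerate case of Cauchy-Schwarz: along \<open>g + cscale c r\<close> the form is
  affine in the real and imaginary parts of \<open>c\<close>, yet it stays nonnegative because these
  elements remain in degree \<open>d\<close>.\<close>

lemma ip_null:
  assumes r: "r \<in> path_algebra_upto \<Gamma> d" "ip r r = 0" and g: "g \<in> path_algebra_upto \<Gamma> d"
  shows "ip r g = 0"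
proof (rule ccontr)
  define z where "z = ip r g"
  assume "ip r g \<noteq> 0"
  then have z: "(cmod z)\<^sup>2 > 0" by (simp add: z_def)
  \<comment> \<open>Chosen so that the form at \<open>g + cscale c r\<close> has real part
    -1.\<close>
  define s where "s = (Re (ip g g) + 1) / (2 * (cmod z)\<^sup>2)"
  define c where "c = - (of_real s * cnj z)"
  have "ip g r = cnj z" unfolding z_def by (rule ip_cnj[symmetric]) (use r g upto_path in blast)+
  then have "ip (g + cscale c r) (g + cscale c r) = ip g g + (c * z + cnj (c * z))"
    using r(2) by (simp add: ip_linear z_def)
  moreover have "c * z = of_real (- s * (cmod z)\<^sup>2)"
    by (simp add: c_def complex_norm_square mult_ac del: of_real_power)
  ultimately have "Re (ip (g + cscale c r) (g + cscale c r)) = Re (ip g g) - 2 * (s * (cmod z)\<^sup>2)"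
    by (simp only: complex_cnj_complex_of_real plus_complex.simps Re_complex_of_real)
  also have "2 * (s * (cmod z)\<^sup>2) = Re (ip g g) + 1"
    using z by (simp add: s_def)
  finally have "Re (ip (g + cscale c r) (g + cscale c r)) < 0" by simp
  moreover have "0 \<le> ip (g + cscale c r) (g + cscale c r)"
    by (intro ip_nonneg upto_closed r g)
  ultimately show False by (simp add: less_eq_complex_def)
qed

section \<open>Maximal orthonormal systems in degree at most \<open>d - 1\<close>\<close>

definition orthonormal :: "nat \<Rightarrow> (nat \<Rightarrow> ('v, 'a) qalg) \<Rightarrow> bool" where
  "orthonormal n u \<longleftrightarrow> (\<forall>i<n. u i \<in> path_algebra_upto \<Gamma> (d - 1)) \<and>
     (\<forall>i<n. \<forall>j<n. ip (u i) (u j) = (if i = j then 1 else 0))"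

text \<open>Pairing a linear relation with \<open>u j\<close> isolates one coefficient, so the
  system is independent. The bound yields both the existence of a maximal system and the admissible
  dimension of the representation.\<close>

lemma orthonormal_le_dim:
  assumes "orthonormal n u"
  shows "n \<le> pm.dim (path_algebra_upto \<Gamma> d)"
proof -
  have on: "ip (u i) (u j) = (if i = j then 1 else 0)" if "i < n" "j < n" for i j
    using assms that by (auto simp: orthonormal_def)
  have inj: "inj_on u {..<n}"
  proof (rule inj_onI)
    fix i j assume "i \<in> {..<n}" "j \<in> {..<n}" "u i = u j"
    with on[of i j] on[of j j] show "i = j" by (auto split: if_splits)
  qed
  have "\<not> pm.dependent (u ` {..<n})"
  proof
    assume "pm.dependent (u ` {..<n})"
    then obtain c v where c: "v \<in> u ` {..<n}" "c v \<noteq> 0" "(\<Sum>v\<in>u ` {..<n}. cscale (c v) v) = 0"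
      by (auto simp: pm.dependent_finite)
    then obtain j where j: "j < n" "v = u j" by auto
    have "0 = ip (\<Sum>i<n. cscale (c (u i)) (u i)) (u j)"
      using c(3) by (simp add: sum.reindex[OF inj])
    also have "\<dots> = (\<Sum>i<n. c (u i) * ip (u i) (u j))" by (simp add: ip_sum ip_linear)
    also have "\<dots> = (\<Sum>i<n. if i = j then c v else 0)"
      using j by (intro sum.cong) (auto simp: on)
    also have "\<dots> = c v" using j by simp
    finally show False using c(2) by simp
  qed
  moreover obtain B where B: "B \<subseteq> path_algebra_upto \<Gamma> d" "pm.independent B"
    "path_algebra_upto \<Gamma> d \<subseteq> pm.span B" "card B = pm.dim (path_algebra_upto \<Gamma> d)"
    using pm.basis_exists by blast
  moreover have "finite B"
    using pm.independent_span_bound[OF finite_imageI[OF finite_qpaths_upto[OF fin_digraph, of d]] B(2)] B(1)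
    unfolding path_algebra_upto_def by auto
  moreover have "u ` {..<n} \<subseteq> path_algebra_upto \<Gamma> d"
    using assms upto_d by (auto simp: orthonormal_def)
  ultimately have "card (u ` {..<n}) \<le> card B"
    using pm.independent_span_bound[of B "u ` {..<n}"] by auto
  with B(4) show ?thesis by (simp add: card_image[OF inj])
qed

definition residual :: "nat \<Rightarrow> (nat \<Rightarrow> ('v, 'a) qalg) \<Rightarrow> ('v, 'a) qalg \<Rightarrow> ('v, 'a) qalg" where
  "residual n u f = f - (\<Sum>i<n. cscale (ip f (u i)) (u i))"

lemma residual_upto:
  assumes "orthonormal n u" "f \<in> path_algebra_upto \<Gamma> (d - 1)"
  shows "residual n u f \<in> path_algebra_upto \<Gamma> (d - 1)"
  unfolding residual_def using assms
  by (intro upto_closed) (auto simp: orthonormal_def)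

lemma ip_residual:
  assumes "orthonormal n u" "j < n"
  shows "ip (residual n u f) (u j) = 0"
proof -
  have "(\<Sum>i<n. ip f (u i) * ip (u i) (u j)) = (\<Sum>i<n. if i = j then ip f (u j) else 0)"
    using assms by (intro sum.cong) (auto simp: orthonormal_def)
  then show ?thesis using assms by (simp add: residual_def ip_minus ip_sum ip_linear)
qed

text \<open>In a system of maximal size every residual is null, since otherwise it could be
  normalised and appended. Such a system represents an orthonormal basis of the quotient by null
  vectors.\<close>

lemma exists_complete_orthonormal:
  "\<exists>n u. orthonormal n u \<and>
     (\<forall>f\<in>path_algebra_upto \<Gamma> (d - 1). ip (residual n u f) (residual n u f) = 0)"
proof -
  have "\<exists>n. (\<exists>u. orthonormal n u) \<and> (\<forall>m. (\<exists>u. orthonormal m u) \<longrightarrow> m \<le> n)"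
  proof (rule Nat.ex_has_greatest_nat[where b = "pm.dim (path_algebra_upto \<Gamma> d)"])
    show "\<exists>u. orthonormal 0 u" by (simp add: orthonormal_def)
    show "\<forall>m. (\<exists>u. orthonormal m u) \<longrightarrow> m \<le> pm.dim (path_algebra_upto \<Gamma> d)"
      using orthonormal_le_dim by blast
  qed
  then obtain n u where u: "orthonormal n u" and max: "\<And>m w. orthonormal m w \<Longrightarrow> m \<le> n" by blast
  have "ip (residual n u f) (residual n u f) = 0" if f: "f \<in> path_algebra_upto \<Gamma> (d - 1)" for f
  proof (rule ccontr)
    define r where "r = residual n u f"
    assume "ip (residual n u f) (residual n u f) \<noteq> 0"
    then have nz: "ip r r \<noteq> 0" by (simp add: r_def)
    have rW: "r \<in> path_algebra_upto \<Gamma> (d - 1)" unfolding r_def by (rule residual_upto[OF u f])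
    with ip_nonneg[OF upto_d] have "0 \<le> ip r r" by blast
    then obtain c where c: "ip r r = of_real c" "c \<ge> 0"
      by (metis complex_is_Real_iff less_eq_complex_def of_real_Re zero_complex.simps)
    with nz have "c > 0" by auto
    define w where "w = u(n := cscale (of_real (1 / sqrt c)) r)"
    have ru: "ip r (u j) = 0" "ip (u j) r = 0" if "j < n" for j
    proof -
      show "ip r (u j) = 0" unfolding r_def by (rule ip_residual[OF u that])
      moreover have "u j \<in> path_algebra \<Gamma>" using u that upto_path by (auto simp: orthonormal_def)
      ultimately show "ip (u j) r = 0" using ip_cnj[of r "u j"] upto_path[OF rW] by simp
    qed
    have "ip (w n) (w n) = of_real (1 / sqrt c) * (of_real (1 / sqrt c) * of_real c)"
      by (simp add: w_def ip_linear c)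
    also have "\<dots> = of_real (1 / sqrt c * (1 / sqrt c) * c)"
      by (simp only: of_real_mult mult.assoc)
    also have "1 / sqrt c * (1 / sqrt c) * c = 1" using \<open>c > 0\<close> by (simp add: field_simps)
    finally have "ip (w n) (w n) = 1" by simp
    then have "orthonormal (Suc n) w"
      using u rW ru by (auto simp: orthonormal_def w_def less_Suc_eq ip_linear upto_closed)
    from max[OF this] show False by simp
  qed
  with u show ?thesis by blast
qed

end

locale gns = positive_functional \<Gamma> d \<psi>
  for \<Gamma> :: "('v, 'a) pre_digraph" and d \<psi> +
  fixes n :: nat and u :: "nat \<Rightarrow> ('v, 'a) qalg"
  assumes orthonormal: "orthonormal n u"
    and complete: "f \<in> path_algebra_upto \<Gamma> (d - 1) \<Longrightarrow> ip (residual n u f) (residual n u f) = 0"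
begin

section \<open>Compressed left multiplications\<close>

lemma u_upto: "i < n \<Longrightarrow> u i \<in> path_algebra_upto \<Gamma> (d - 1)"
  using orthonormal by (simp add: orthonormal_def)

lemma u_path: "i < n \<Longrightarrow> u i \<in> path_algebra \<Gamma>"
  using u_upto upto_path by blast

lemma qmult_upto_Suc:
  assumes "x \<in> path_algebra_upto \<Gamma> 1" "f \<in> path_algebra_upto \<Gamma> (d - 1)"
  shows "qmult \<Gamma> x f \<in> path_algebra_upto \<Gamma> d"
  using qmult_upto[OF fin_digraph assms] d_pos by simp

text \<open>The residual of \<open>f\<close> is null. Moving \<open>x\<close> to the other side of
  the form pairs this residual with an element of degree at most \<open>d\<close>, so
  \<open>ip_null\<close> removes it. Thus \<open>f\<close> may be replaced by its projection before
  \<open>x\<close> acts, even if \<open>qmult \<Gamma> x f\<close> leaves degree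
  \<open>d - 1\<close>.\<close>

lemma compression:
  assumes x: "x \<in> path_algebra_upto \<Gamma> 1" and f: "f \<in> path_algebra_upto \<Gamma> (d - 1)"
    and g: "g \<in> path_algebra_upto \<Gamma> (d - 1)"
  shows "(\<Sum>k<n. ip (qmult \<Gamma> x (u k)) g * ip f (u k)) = ip (qmult \<Gamma> x f) g"
proof -
  define r where "r = residual n u f"
  have f_eq: "f = r + (\<Sum>k<n. cscale (ip f (u k)) (u k))" by (simp add: r_def residual_def)
  have r: "r \<in> path_algebra_upto \<Gamma> d" "ip r r = 0"
    using residual_upto[OF orthonormal f] complete[OF f] upto_d by (simp_all add: r_def)
  have "ip (qmult \<Gamma> x r) g = ip r (qmult \<Gamma> (qstar \<Gamma> x) g)"
    by (rule ip_qmult) (use x g upto_path in auto)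
  also have "\<dots> = 0"
    by (intro ip_null[OF r] qmult_upto_Suc qstar_upto[OF fin_digraph] x g)
  finally have 0: "ip (qmult \<Gamma> x r) g = 0" .
  have "ip (qmult \<Gamma> x f) g = ip (qmult \<Gamma> x (r + (\<Sum>k<n. cscale (ip f (u k)) (u k)))) g"
    by (subst (1) f_eq) (rule refl)
  also have "\<dots> = (\<Sum>k<n. ip (qmult \<Gamma> x (u k)) g * ip f (u k))"
    by (simp add: qmult_linear qmult_sum_right ip_linear ip_sum 0 mult.commute)
  finally show ?thesis by simp
qed

text \<open>The matrix of left multiplication by \<open>x\<close> followed by orthogonal projection.
  It is multiplicative only in special cases, among them a product with a vertex factor.\<close>

definition opm :: "('v, 'a) qalg \<Rightarrow> complex mat" where
  "opm x = Matrix.mat n n (\<lambda>(i, j). ip (qmult \<Gamma> x (u j)) (u i))"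

definition coords :: "('v, 'a) qalg \<Rightarrow> complex Matrix.vec" where
  "coords f = Matrix.vec n (\<lambda>i. ip f (u i))"

lemma opm_carrier [simp]: "opm x \<in> carrier_mat n n"
  by (simp add: opm_def)

lemma coords_carrier [simp]: "coords f \<in> carrier_vec n"
  by (simp add: coords_def)

lemma qmult_vertex_upto:
  "x \<in> path_algebra_upto \<Gamma> 0 \<Longrightarrow> f \<in> path_algebra_upto \<Gamma> t \<Longrightarrow> qmult \<Gamma> x f \<in> path_algebra_upto \<Gamma> t"
  using qmult_upto[OF fin_digraph, of x 0 f t] by simp

lemma opm_mult_vertex_right:
  assumes x: "x \<in> path_algebra_upto \<Gamma> 1" and y: "y \<in> path_algebra_upto \<Gamma> 0"
  shows "opm x * opm y = opm (qmult \<Gamma> x y)"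
proof (rule eq_matI)
  fix i j assume "i < dim_row (opm (qmult \<Gamma> x y))" "j < dim_col (opm (qmult \<Gamma> x y))"
  then have ij: "i < n" "j < n" by (simp_all add: opm_def)
  have "(opm x * opm y) $$ (i, j) =
      (\<Sum>k<n. ip (qmult \<Gamma> x (u k)) (u i) * ip (qmult \<Gamma> y (u j)) (u k))"
    using ij by (simp add: opm_def scalar_prod_def lessThan_atLeast0)
  also have "\<dots> = ip (qmult \<Gamma> x (qmult \<Gamma> y (u j))) (u i)"
    by (intro compression x qmult_vertex_upto y u_upto ij)
  finally show "(opm x * opm y) $$ (i, j) = opm (qmult \<Gamma> x y) $$ (i, j)"
    using ij by (simp add: opm_def qmult_assoc)
qed (simp_all add: opm_def)

text \<open>Here \<open>qmult \<Gamma> y (u j)\<close> may have degree \<open>d\<close>, out of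
  reach of \<open>compression\<close>. Taking adjoints lets the degree 0 factor act first on
  \<open>u i\<close>, which keeps degree \<open>d - 1\<close>.\<close>

lemma opm_mult_vertex_left:
  assumes x: "x \<in> path_algebra_upto \<Gamma> 0" and y: "y \<in> path_algebra_upto \<Gamma> 1"
  shows "opm x * opm y = opm (qmult \<Gamma> x y)"
proof (rule eq_matI)
  fix i j assume "i < dim_row (opm (qmult \<Gamma> x y))" "j < dim_col (opm (qmult \<Gamma> x y))"
  then have ij: "i < n" "j < n" by (simp_all add: opm_def)
  let ?x = "qstar \<Gamma> x" and ?y = "qstar \<Gamma> y"
  have xy: "?x \<in> path_algebra_upto \<Gamma> 0" "?y \<in> path_algebra_upto \<Gamma> 1"
    using x y qstar_upto[OF fin_digraph] by blast+
  have paths: "x \<in> path_algebra \<Gamma>" "y \<in> path_algebra \<Gamma>" "?x \<in> path_algebra \<Gamma>" "?y \<in> path_algebra \<Gamma>"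
    using x y xy upto_path by blast+
  have closed: "qmult \<Gamma> ?x (u i) \<in> path_algebra \<Gamma>" "qmult \<Gamma> ?y (u k) \<in> path_algebra \<Gamma>" if "k < n" for k
    using qmult_in_path_algebra[OF fin_digraph] paths u_path that ij by blast+
  have "(opm x * opm y) $$ (i, j) =
      (\<Sum>k<n. ip (qmult \<Gamma> x (u k)) (u i) * ip (qmult \<Gamma> y (u j)) (u k))"
    using ij by (simp add: opm_def scalar_prod_def lessThan_atLeast0)
  also have "\<dots> = (\<Sum>k<n. cnj (ip (qmult \<Gamma> ?y (u k)) (u j) * ip (qmult \<Gamma> ?x (u i)) (u k)))"
  proof (intro sum.cong refl)
    fix k assume "k \<in> {..<n}"
    then have k: "k < n" by simp
    show "ip (qmult \<Gamma> x (u k)) (u i) * ip (qmult \<Gamma> y (u j)) (u k) =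
        cnj (ip (qmult \<Gamma> ?y (u k)) (u j) * ip (qmult \<Gamma> ?x (u i)) (u k))"
      unfolding ip_adjoint[OF paths(1) u_path[OF k] u_path[OF ij(1)]]
        ip_adjoint[OF paths(2) u_path[OF ij(2)] u_path[OF k]] by (simp add: mult.commute)
  qed
  also have "\<dots> = cnj (ip (qmult \<Gamma> ?y (qmult \<Gamma> ?x (u i))) (u j))"
    by (subst compression[symmetric]) (use xy ij u_upto qmult_vertex_upto in auto)
  also have "\<dots> = ip (u j) (qmult \<Gamma> ?y (qmult \<Gamma> ?x (u i)))"
    by (intro ip_cnj qmult_in_path_algebra fin_digraph paths u_path ij)
  also have "\<dots> = ip (qmult \<Gamma> x (qmult \<Gamma> y (u j))) (u i)"
    using ij u_path paths closed by (simp add: ip_qmult_right fin_digraph qstar_qstar)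
  finally show "(opm x * opm y) $$ (i, j) = opm (qmult \<Gamma> x y) $$ (i, j)"
    using ij by (simp add: opm_def qmult_assoc)
qed (simp_all add: opm_def)

lemma opm_coords:
  assumes "x \<in> path_algebra_upto \<Gamma> 1" "f \<in> path_algebra_upto \<Gamma> (d - 1)"
  shows "opm x *\<^sub>v coords f = coords (qmult \<Gamma> x f)"
proof (rule eq_vecI)
  fix i assume "i < dim_vec (coords (qmult \<Gamma> x f))"
  then have i: "i < n" by (simp add: coords_def)
  have "(opm x *\<^sub>v coords f) $ i = (\<Sum>k<n. ip (qmult \<Gamma> x (u k)) (u i) * ip f (u k))"
    using i by (simp add: opm_def coords_def scalar_prod_def lessThan_atLeast0)
  also have "\<dots> = ip (qmult \<Gamma> x f) (u i)"
    by (intro compression assms u_upto i)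
  finally show "(opm x *\<^sub>v coords f) $ i = coords (qmult \<Gamma> x f) $ i"
    using i by (simp add: coords_def)
qed (simp add: opm_def coords_def)

lemma opm_adjoint:
  assumes "x \<in> path_algebra \<Gamma>"
  shows "mat_adjoint (opm x) = opm (qstar \<Gamma> x)"
proof (rule eq_matI)
  fix i j assume "i < dim_row (opm (qstar \<Gamma> x))" "j < dim_col (opm (qstar \<Gamma> x))"
  then have ij: "i < n" "j < n" by (simp_all add: opm_def)
  have "mat_adjoint (opm x) $$ (i, j) = cnj (ip (qmult \<Gamma> x (u i)) (u j))"
    using ij by (simp add: opm_def)
  also have "\<dots> = ip (u j) (qmult \<Gamma> x (u i))"
    by (intro ip_cnj qmult_in_path_algebra fin_digraph assms u_path ij)
  also have "\<dots> = ip (qmult \<Gamma> (qstar \<Gamma> x) (u j)) (u i)"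
    by (intro ip_qmult_right assms u_path ij)
  finally show "mat_adjoint (opm x) $$ (i, j) = opm (qstar \<Gamma> x) $$ (i, j)"
    using ij by (simp add: opm_def)
qed (simp_all add: opm_def)

section \<open>Path matrices and the representation they define\<close>

abbreviation arrow :: "'a + 'a \<Rightarrow> ('v, 'a) qalg" where
  "arrow b \<equiv> basis_elem (tail (double \<Gamma>) b, [b])"

abbreviation vertex :: "'v \<Rightarrow> ('v, 'a) qalg" where
  "vertex e \<equiv> basis_elem (e, [])"

text \<open>Each product ends with the matrix of the final vertex. The last arrow absorbs it by
  \<open>arrow_vertex\<close>, and for an empty path it is the required value.\<close>

primrec path_mat :: "'v \<Rightarrow> ('a + 'a) list \<Rightarrow> complex mat" where
  "path_mat e [] = opm (vertex e)"
| "path_mat e (b # bs) = opm (arrow b) * path_mat (head (double \<Gamma>) b) bs"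

lemma path_mat_carrier [simp]: "path_mat e bs \<in> carrier_mat n n"
  by (induction bs arbitrary: e) (simp_all add: mult_carrier_mat[OF opm_carrier])

lemma vertex_upto: "e \<in> verts \<Gamma> \<Longrightarrow> vertex e \<in> path_algebra_upto \<Gamma> t"
  using fin_digraph by (intro basis_in_upto) (auto simp: qpaths_Nil)

lemma arrow_upto:
  assumes "b \<in> arcs (double \<Gamma>)"
  shows "arrow b \<in> path_algebra_upto \<Gamma> 1" "tail (double \<Gamma>) b \<in> verts \<Gamma>" "head (double \<Gamma>) b \<in> verts \<Gamma>"
proof -
  interpret D: fin_digraph "double \<Gamma>" by (rule fin_digraph_double[OF fin_digraph])
  show *: "tail (double \<Gamma>) b \<in> verts \<Gamma>" "head (double \<Gamma>) b \<in> verts \<Gamma>"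
    using D.tail_in_verts[OF assms] D.head_in_verts[OF assms] by simp_all
  show "arrow b \<in> path_algebra_upto \<Gamma> 1"
    using assms fin_digraph * by (intro basis_in_upto) (auto simp: qpaths_Nil qpaths_Cons)
qed

lemma opm_0: "opm 0 = 0\<^sub>m n n"
  by (rule eq_matI) (auto simp: opm_def)

lemma vertex_vertex:
  assumes "e \<in> verts \<Gamma>" "e' \<in> verts \<Gamma>"
  shows "opm (vertex e) * opm (vertex e') = (if e = e' then opm (vertex e) else 0\<^sub>m n n)"
  using assms by (auto simp: opm_mult_vertex_left vertex_upto qmult_basis qconcat_def qend_simp opm_0)

lemma vertex_arrow:
  assumes "e \<in> verts \<Gamma>" "b \<in> arcs (double \<Gamma>)"
  shows "opm (vertex e) * opm (arrow b) = (if e = tail (double \<Gamma>) b then opm (arrow b) else 0\<^sub>m n n)"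
  using assms arrow_upto(1)[OF assms(2)]
  by (auto simp: opm_mult_vertex_left vertex_upto qmult_basis qconcat_def qend_simp opm_0)

lemma arrow_vertex:
  assumes "e \<in> verts \<Gamma>" "b \<in> arcs (double \<Gamma>)"
  shows "opm (arrow b) * opm (vertex e) = (if head (double \<Gamma>) b = e then opm (arrow b) else 0\<^sub>m n n)"
  using assms arrow_upto(1)[OF assms(2)]
  by (auto simp: opm_mult_vertex_right vertex_upto qmult_basis qconcat_def qend_simp opm_0)

lemma vertex_path_mat:
  assumes "e \<in> verts \<Gamma>" "(w, bs) \<in> qpaths \<Gamma>"
  shows "opm (vertex e) * path_mat w bs = (if e = w then path_mat w bs else 0\<^sub>m n n)"
proof (cases bs)
  case Nil
  with assms fin_digraph show ?thesis by (simp add: vertex_vertex qpaths_Nil)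
next
  case (Cons b cs)
  with assms fin_digraph have b: "b \<in> arcs (double \<Gamma>)" "w = tail (double \<Gamma>) b"
    by (simp_all add: qpaths_Cons)
  have "opm (vertex e) * path_mat w bs =
      opm (vertex e) * opm (arrow b) * path_mat (head (double \<Gamma>) b) cs"
    unfolding Cons path_mat.simps by (rule assoc_mult_mat[symmetric]) (rule opm_carrier path_mat_carrier)+
  then show ?thesis
    using b by (simp add: vertex_arrow[OF assms(1) b(1)] Cons left_mult_zero_mat[OF path_mat_carrier])
qed

text \<open>Associativity peels off the first path arrow by arrow down to its final vertex, where
  \<open>vertex_path_mat\<close> decides whether the second path can follow. No multiplicativity of
  \<open>opm\<close> on pairs of arrows enters.\<close>

lemma path_mat_mult:
  assumes "(v, bs) \<in> qpaths \<Gamma>" "(w, cs) \<in> qpaths \<Gamma>"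
  shows "path_mat v bs * path_mat w cs =
    (if qend \<Gamma> (v, bs) = w then path_mat v (bs @ cs) else 0\<^sub>m n n)"
  using assms(1)
proof (induction bs arbitrary: v)
  case Nil
  with assms(2) fin_digraph show ?case
    by (auto simp: vertex_path_mat qpaths_Nil qend_simp)
next
  case (Cons b bs)
  then have IH: "path_mat (head (double \<Gamma>) b) bs * path_mat w cs =
      (if qend \<Gamma> (head (double \<Gamma>) b, bs) = w then path_mat (head (double \<Gamma>) b) (bs @ cs) else 0\<^sub>m n n)"
    using fin_digraph by (simp add: qpaths_Cons)
  have "path_mat v (b # bs) * path_mat w cs =
      opm (arrow b) * (path_mat (head (double \<Gamma>) b) bs * path_mat w cs)"
    unfolding path_mat.simps by (rule assoc_mult_mat) (rule opm_carrier path_mat_carrier)+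
  then show ?case
    by (simp add: IH qend_Cons right_mult_zero_mat[OF opm_carrier])
qed

lemma path_mat_adjoint:
  assumes "(v, bs) \<in> qpaths \<Gamma>"
  shows "mat_adjoint (path_mat v bs) = path_mat (qend \<Gamma> (v, bs)) (rev (map flip_arrow bs))"
  using assms
proof (induction bs arbitrary: v)
  case Nil
  then have "vertex v \<in> path_algebra \<Gamma>"
    using fin_digraph basis_in_path_algebra by blast
  then show ?case by (simp add: opm_adjoint qend_simp qpath_star_def)
next
  case (Cons b bs)
  let ?h = "head (double \<Gamma>) b" and ?b = "flip_arrow b"
  have b: "b \<in> arcs (double \<Gamma>)" "v = tail (double \<Gamma>) b" "(?h, bs) \<in> qpaths \<Gamma>"
    using Cons.prems fin_digraph by (simp_all add: qpaths_Cons)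
  have "?b \<in> arcs (double \<Gamma>)" using b by simp
  \<comment> \<open>The reversed arrow is rewritten as a path of length one, so that
    \<open>path_mat_mult\<close> can append it.\<close>
  from arrow_upto[OF this] have fb: "path_mat ?h [?b] = opm (arrow ?b)" "(?h, [?b]) \<in> qpaths \<Gamma>"
    using b fin_digraph arrow_upto[OF b(1)] arrow_vertex[of "tail (double \<Gamma>) b" "?b"]
    by (simp_all add: qpaths_Nil qpaths_Cons)
  let ?p = "qpath_star \<Gamma> (?h, bs)"
  have p: "?p \<in> qpaths \<Gamma>" "qend \<Gamma> ?p = ?h"
    using qpath_star[OF fin_digraph b(3)] by simp_all
  have "mat_adjoint (path_mat v (b # bs)) = mat_adjoint (path_mat ?h bs) * mat_adjoint (opm (arrow b))"
    by (simp add: mat_adjoint_mult[OF opm_carrier path_mat_carrier])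
  also have "mat_adjoint (opm (arrow b)) = path_mat ?h [?b]"
    using opm_adjoint[OF upto_path[OF arrow_upto(1)[OF b(1)]]]
    unfolding fb(1) by (simp add: qpath_star_def qend_simp)
  also have "mat_adjoint (path_mat ?h bs) = path_mat (fst ?p) (snd ?p)"
    unfolding Cons.IH[OF b(3)] by (simp add: qpath_star_def)
  also have "path_mat (fst ?p) (snd ?p) * path_mat ?h [?b] = path_mat (fst ?p) (snd ?p @ [?b])"
    using p fb(2) by (subst path_mat_mult) simp_all
  finally show ?case by (simp add: qpath_star_def qend_Cons)
qed

text \<open>The arrows act from the right end, each on the coordinates of a suffix shorter than
  \<open>d\<close>, and there \<open>opm_coords\<close> identifies the compression with true
  multiplication.\<close>

lemma path_mat_coords:
  assumes "(v, bs) \<in> qpaths \<Gamma>" "length bs \<le> d - 1"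
  shows "path_mat v bs *\<^sub>v coords (qone \<Gamma>) = coords (basis_elem (v, bs))"
  using assms
proof (induction bs arbitrary: v)
  case Nil
  then have "vertex v \<in> path_algebra_upto \<Gamma> 1" using fin_digraph by (intro basis_in_upto) auto
  then show ?case
    by (simp add: opm_coords qone_in_upto fin_digraph qmult_qone upto_path)
next
  case (Cons b bs)
  let ?h = "head (double \<Gamma>) b"
  have b: "b \<in> arcs (double \<Gamma>)" "v = tail (double \<Gamma>) b" "(?h, bs) \<in> qpaths \<Gamma>"
    using Cons.prems fin_digraph by (simp_all add: qpaths_Cons)
  have "path_mat v (b # bs) *\<^sub>v coords (qone \<Gamma>) =
      opm (arrow b) *\<^sub>v (path_mat ?h bs *\<^sub>v coords (qone \<Gamma>))"
    unfolding path_mat.simps by (rule assoc_mult_mat_vec) (rule opm_carrier path_mat_carrier coords_carrier)+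
  also have "\<dots> = opm (arrow b) *\<^sub>v coords (basis_elem (?h, bs))"
    using Cons.IH[OF b(3)] Cons.prems by simp
  also have "\<dots> = coords (qmult \<Gamma> (arrow b) (basis_elem (?h, bs)))"
    using Cons.prems by (intro opm_coords arrow_upto b basis_in_upto fin_digraph) simp
  also have "qmult \<Gamma> (arrow b) (basis_elem (?h, bs)) = basis_elem (v, b # bs)"
    by (simp add: qmult_basis qconcat_def qend_simp b(2))
  finally show ?case .
qed

text \<open>The linear extension of \<open>path_mat\<close>, written entrywise so that the sum over
  the support is one of complex numbers and the empty sum has the right size.\<close>

definition rep :: "('v, 'a) qalg \<Rightarrow> complex mat" where
  "rep x = Matrix.mat n n (\<lambda>ij. \<Sum>p\<in>Poly_Mapping.keys x.
     Poly_Mapping.lookup x p * path_mat (fst p) (snd p) $$ ij)"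

lemma rep_carrier [simp]: "rep x \<in> carrier_mat n n"
  by (simp add: rep_def)

lemma rep_superset:
  assumes "finite P" "Poly_Mapping.keys x \<subseteq> P"
  shows "rep x = Matrix.mat n n (\<lambda>ij. \<Sum>p\<in>P. Poly_Mapping.lookup x p * path_mat (fst p) (snd p) $$ ij)"
  unfolding rep_def using assms
  by (intro eq_matI) (auto simp: in_keys_iff intro!: sum.mono_neutral_left)

lemma rep_add: "rep (x + y) = rep x + rep y"
  by (subst (1 2 3) rep_superset[of "Poly_Mapping.keys x \<union> Poly_Mapping.keys y"])
    (auto simp: Poly_Mapping.keys_add lookup_add algebra_simps sum.distrib intro!: eq_matI)

lemma rep_cscale: "rep (cscale c x) = c \<cdot>\<^sub>m rep x"
  by (subst (1 2) rep_superset[of "Poly_Mapping.keys x"])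
    (auto simp: keys_cscale sum_distrib_left mult.assoc intro!: eq_matI)

lemma rep_0: "rep 0 = 0\<^sub>m n n"
  by (intro eq_matI) (simp_all add: rep_def)

lemma rep_basis: "rep (basis_elem p) = path_mat (fst p) (snd p)"
  by (intro eq_matI) (simp_all add: rep_def carrier_matD[OF path_mat_carrier])

lemma rep_qconcat:
  assumes "p \<in> qpaths \<Gamma>" "r \<in> qpaths \<Gamma>"
  shows "rep (qconcat \<Gamma> p r) = rep (basis_elem p) * rep (basis_elem r)"
  using assms path_mat_mult[of "fst p" "snd p" "fst r" "snd r"]
  by (simp add: rep_basis qconcat_def rep_0)

lemma rep_qmult:
  assumes "x \<in> path_algebra \<Gamma>" "y \<in> path_algebra \<Gamma>"
  shows "rep (qmult \<Gamma> x y) = rep x * rep y"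
  using assms(1)
proof (induction rule: path_algebra_induct)
  case zero
  then show ?case by (simp add: rep_0 left_mult_zero_mat[OF rep_carrier])
next
  case (step c p x)
  have basis: "rep (qmult \<Gamma> (basis_elem p) y) = rep (basis_elem p) * rep y"
    using assms(2)
  proof (induction rule: path_algebra_induct)
    case zero
    then show ?case by (simp add: rep_0 right_mult_zero_mat[OF rep_carrier])
  next
    case (step c r y)
    have "rep (basis_elem p) * (c \<cdot>\<^sub>m rep (basis_elem r) + rep y) =
        rep (basis_elem p) * (c \<cdot>\<^sub>m rep (basis_elem r)) + rep (basis_elem p) * rep y"
      by (rule mult_add_distrib_mat) (rule rep_carrier smult_carrier_mat)+
    then show ?case
      using step rep_qconcat[OF \<open>p \<in> qpaths \<Gamma>\<close> step(1)]
      by (simp add: qmult_linear qmult_basis rep_add rep_cscale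
        mult_smult_distrib[OF rep_carrier rep_carrier])
  qed
  have "(c \<cdot>\<^sub>m rep (basis_elem p) + rep x) * rep y = c \<cdot>\<^sub>m rep (basis_elem p) * rep y + rep x * rep y"
    by (rule add_mult_distrib_mat) (rule rep_carrier smult_carrier_mat)+
  with step basis show ?case
    by (simp add: qmult_linear rep_add rep_cscale mult_smult_assoc_mat[OF rep_carrier rep_carrier])
qed

lemma rep_qstar:
  assumes "x \<in> path_algebra \<Gamma>"
  shows "rep (qstar \<Gamma> x) = mat_adjoint (rep x)"
  using assms
proof (induction rule: path_algebra_induct)
  case zero
  show ?case by (intro eq_matI) (simp_all add: rep_0)
next
  case (step c p x)
  have "rep (basis_elem (qpath_star \<Gamma> p)) = mat_adjoint (rep (basis_elem p))"
    using path_mat_adjoint[of "fst p" "snd p"] step(1) by (simp add: rep_basis qpath_star_def)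
  then have "rep (qstar \<Gamma> (cscale c (basis_elem p) + x)) =
      cnj c \<cdot>\<^sub>m mat_adjoint (rep (basis_elem p)) + mat_adjoint (rep x)"
    using step by (simp add: qstar_add qstar_cscale rep_add rep_cscale)
  also have "\<dots> = mat_adjoint (rep (cscale c (basis_elem p) + x))"
    unfolding rep_add rep_cscale by (intro eq_matI) (simp_all add: carrier_matD[OF rep_carrier])
  finally show ?case .
qed

text \<open>On sums of vertices \<open>rep\<close> agrees with \<open>opm\<close>, and the unit acts
  trivially, so the result is the Gram matrix of the orthonormal system.\<close>

lemma rep_qone: "rep (qone \<Gamma>) = 1\<^sub>m n"
proof (rule eq_matI)
  fix i j assume "i < dim_row (1\<^sub>m n)" "j < dim_col (1\<^sub>m n)"
  then have ij: "i < n" "j < n" by simp_all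
  have "rep (\<Sum>e\<in>A. vertex e) $$ (i, j) = ip (qmult \<Gamma> (\<Sum>e\<in>A. vertex e) (u j)) (u i)"
    if "finite A" for A
    using that
  proof (induction rule: finite_induct)
    case (insert e A)
    with ij show ?case
      by (simp add: rep_add qmult_linear ip_linear rep_basis carrier_matD[OF rep_carrier])
        (simp add: opm_def)
  qed (use ij in \<open>simp add: rep_0\<close>)
  moreover have "finite (verts \<Gamma>)" using fin_digraph by (simp add: fin_digraph.finite_verts)
  ultimately have "rep (qone \<Gamma>) $$ (i, j) = ip (qmult \<Gamma> (qone \<Gamma>) (u j)) (u i)"
    unfolding qone_def by blast
  then have "rep (qone \<Gamma>) $$ (i, j) = ip (u j) (u i)"
    using ij by (simp add: qone_qmult fin_digraph u_path)
  then show "rep (qone \<Gamma>) $$ (i, j) = 1\<^sub>m n $$ (i, j)"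
    using ij orthonormal by (simp add: orthonormal_def)
qed (simp_all add: carrier_matD[OF rep_carrier])

lemma star_representation_rep: "star_representation \<Gamma> n rep"
  unfolding star_representation_def
  by (simp add: rep_add rep_cscale rep_qmult rep_qstar rep_qone)

section \<open>The vector state of the unit\<close>

lemma coords_linear:
  "coords (f + g) = coords f + coords g"
  "coords (cscale c f) = c \<cdot>\<^sub>v coords f"
  by (auto simp: coords_def ip_linear intro!: eq_vecI)

lemma rep_coords:
  assumes "x \<in> path_algebra_upto \<Gamma> (d - 1)"
  shows "rep x *\<^sub>v coords (qone \<Gamma>) = coords x"
  using assms
proof (induction rule: path_algebra_upto_induct)
  case zero
  show ?case by (intro eq_vecI) (simp_all add: rep_0 coords_def)
next
  case (step c p x)
  let ?v = "coords (qone \<Gamma>)"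
  have "(c \<cdot>\<^sub>m rep (basis_elem p) + rep x) *\<^sub>v ?v = c \<cdot>\<^sub>m rep (basis_elem p) *\<^sub>v ?v + rep x *\<^sub>v ?v"
    by (rule add_mult_distrib_mat_vec) (rule rep_carrier smult_carrier_mat coords_carrier)+
  also have "c \<cdot>\<^sub>m rep (basis_elem p) *\<^sub>v ?v = c \<cdot>\<^sub>v (rep (basis_elem p) *\<^sub>v ?v)"
    by (intro eq_vecI) (auto simp: carrier_matD[OF rep_carrier] carrier_vecD[OF coords_carrier])
  also have "rep (basis_elem p) *\<^sub>v ?v = coords (basis_elem p)"
    using path_mat_coords[of "fst p" "snd p"] step by (simp add: rep_basis)
  finally show ?case using step by (simp add: rep_add rep_cscale coords_linear)
qed

text \<open>After \<open>rep_coords\<close> the left side is the coordinate pairing of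
  \<open>x\<close> with the unit. Parseval's identity, which is \<open>compression\<close> for
  multiplication by the unit, turns it into the form, whose value there is \<psi> at
  \<open>x\<close>.\<close>

lemma vector_state:
  assumes x: "x \<in> path_algebra_upto \<Gamma> (d - 1)"
  shows "(rep x *\<^sub>v coords (qone \<Gamma>)) \<bullet>c coords (qone \<Gamma>) = \<psi> x"
proof -
  have one: "qone \<Gamma> \<in> path_algebra_upto \<Gamma> t" for t by (rule qone_in_upto[OF fin_digraph])
  have "(rep x *\<^sub>v coords (qone \<Gamma>)) \<bullet>c coords (qone \<Gamma>) = (\<Sum>k<n. ip x (u k) * cnj (ip (qone \<Gamma>) (u k)))"
    unfolding rep_coords[OF x] by (simp add: coords_def scalar_prod_def lessThan_atLeast0)
  also have "\<dots> = (\<Sum>k<n. ip (qmult \<Gamma> (qone \<Gamma>) (u k)) (qone \<Gamma>) * ip x (u k))"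
    by (intro sum.cong refl)
      (simp add: ip_cnj u_path upto_path[OF one] qone_qmult fin_digraph mult.commute)
  also have "\<dots> = ip (qmult \<Gamma> (qone \<Gamma>) x) (qone \<Gamma>)"
    by (intro compression one x)
  also have "\<dots> = \<psi> x"
    using upto_path[OF x] by (simp add: ip_def qone_qmult qstar_qone fin_digraph)
  finally show ?thesis .
qed

end

theorem theorem7:
  fixes \<Gamma> :: "('v, 'a) pre_digraph" and d :: nat and q :: "('v, 'a) qalg"
  assumes "fin_digraph \<Gamma>"
    and "d \<ge> 1"
    and "q \<in> path_algebra_upto \<Gamma> (d - 1)"
    and "qstar \<Gamma> q = q"
    and "\<And>n \<pi>. n \<le> pm.dim (path_algebra_upto \<Gamma> d) \<Longrightarrow> star_representation \<Gamma> n \<pi> \<Longrightarrow>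
           positive_semidefinite (\<pi> q)"
  shows "q \<in> sos_hull \<Gamma> d"
proof (rule ccontr)
  assume "q \<notin> sos_hull \<Gamma> d"
  from separating_functional[OF assms(1,4) this] obtain \<psi> where \<psi>:
    "\<And>x y. \<psi> (x + y) = \<psi> x + \<psi> y" "\<And>c x. \<psi> (cscale c x) = c * \<psi> x"
    "\<And>x. x \<in> path_algebra \<Gamma> \<Longrightarrow> \<psi> (qstar \<Gamma> x) = cnj (\<psi> x)"
    "\<And>f. f \<in> path_algebra_upto \<Gamma> d \<Longrightarrow> 0 \<le> \<psi> (qmult \<Gamma> f (qstar \<Gamma> f))" "\<psi> q < 0"
    by blast
  interpret positive_functional \<Gamma> d \<psi>
    by (intro positive_functional.intro assms(1,2) \<psi>)
  obtain n u where u: "orthonormal n u"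
    "\<forall>f\<in>path_algebra_upto \<Gamma> (d - 1). ip (residual n u f) (residual n u f) = 0"
    using exists_complete_orthonormal by blast
  interpret gns \<Gamma> d \<psi> n u
    by unfold_locales (use u in auto)
  have "positive_semidefinite (rep q)"
    by (rule assms(5)[OF orthonormal_le_dim[OF u(1)] star_representation_rep])
  then have "0 \<le> (rep q *\<^sub>v coords (qone \<Gamma>)) \<bullet>c coords (qone \<Gamma>)"
    using rep_carrier[of q] by (simp add: positive_semidefinite_def)
  with \<psi>(5) show False by (simp add: vector_state[OF assms(3)])
qed

end
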